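(* Let $k$ be a field of characteristic not $2$, $G$ a finite Abelian group and $F$ a cochain on $G$. Let $V$ be a $k$-vector space of even dimension $\dim(V)=2m$ with nondegenerate quadratic form $\mathbf{q}$, with orthogonal basis $e_1,\dots,e_{2m}$ and $\mathbf{q}(e_i)=q_i\neq0$. Let $\sigma(e_x)=s(x)e_x$ be an involutive automorphism of $k_FG$ defined by $s$ of the form $s(x)=(-1)^{\rho(x)}$ for a $\mathbb{Z}$-valued function $\rho$ on $G$. Then $$k_FG\,\underline{\otimes}\,C(V,\mathbf{q})\cong k_{F'}G\otimes C(V,\mathbf{q}),$$ where $$F'(x,y)=F(x,y)\left((-1)^{m(2m-1)}q_1\cdots q_{2m}\right)^{\frac12(\rho(xy)-\rho(x)-\rho(y))}.$$ If $\imath=\sqrt{-1}\in k$ then $F'$ is cohomologous to $F$.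
   Context: A cochain on $G$ is a nowhere-zero function $F:G\times G\to k$ with $F(e,x)=F(x,e)=1$, where $e$ is the group identity. $k_FG$ is the algebra with basis labelled by $G$ (written $e_x$, $x\in G$) and product $e_x\cdot e_y=F(x,y)e_{xy}$; $k_{F'}G$ is defined by the same product formula with $F'$ in place of $F$. $C(V,\mathbf{q})$ is the associative unital algebra generated by $e_1,\dots,e_{2m}$ with $e_i^2=q_i\cdot1$, $e_ie_j+e_je_i=0$ for $i\neq j$, and it is a super algebra with all $e_i$ odd. $k_FG$ is a super algebra via $\sigma$, with $e_x$ of degree $\rho(x)$ mod $2$. $\underline{\otimes}$ is the super tensor product, $(a\otimes c)(b\otimes d)=(-1)^{|c||b|}ab\otimes cd$ for homogeneous $b,c$; $\otimes$ is the ordinary tensor product of algebras, and $\cong$ denotes isomorphism of algebras. $F'$ is cohomologous to $F$ if $F'(x,y)=F(x,y)\chi(x)\chi(y)/\chi(xy)$ for some $\chi:G\to k^*$. Involutive automorphism means an automorphism with $\sigma^2=\mathrm{id}$.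
   Formalization: The last sentence is proved under the extra hypothesis that q_1⋯q_{2m} is a square in k; with only √-1 in k it fails, e.g. k=Q(i), G of order 2, F=1, ρ=0,1, m=1, q=(1,2), where F'(g,g)=-1/2 is not a square. *)

theory Defs
  imports "HOL-Algebra.Group" "HOL-Library.Poly_Mapping" "HOL-Computational_Algebra.Computational_Algebra"
begin

section \<open>Algebras over a field\<close>

text \<open>
  Algebras over the field \<open>'k\<close> are not assumed associative, since \<open>k\<^sub>F G\<close> is in general not
  associative. No unit is recorded: a bijective multiplicative map automatically carries
  a unit to a unit. A super algebra is an algebra together with the maps
  sending an element to its homogeneous component of degree 0, respectively 1.
\<close>

record ('k, 'a) kalgebra = "'a partial_object" +
  vzero :: 'a
  vadd :: "'a \<Rightarrow> 'a \<Rightarrow> 'a"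
  vscale :: "'k \<Rightarrow> 'a \<Rightarrow> 'a"
  vmult :: "'a \<Rightarrow> 'a \<Rightarrow> 'a"

record ('k, 'a) super_kalgebra = "('k, 'a) kalgebra" +
  hcomp :: "nat \<Rightarrow> 'a \<Rightarrow> 'a"

definition kalgebra_iso ::
  "('k, 'a, 'x) kalgebra_scheme \<Rightarrow> ('k, 'b, 'y) kalgebra_scheme \<Rightarrow> ('a \<Rightarrow> 'b) \<Rightarrow> bool" where
  "kalgebra_iso A B \<phi> \<longleftrightarrow>
     bij_betw \<phi> (carrier A) (carrier B) \<and>
     (\<forall>x\<in>carrier A. \<forall>y\<in>carrier A. \<phi> (vadd A x y) = vadd B (\<phi> x) (\<phi> y)) \<and>
     (\<forall>c. \<forall>x\<in>carrier A. \<phi> (vscale A c x) = vscale B c (\<phi> x)) \<and>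
     (\<forall>x\<in>carrier A. \<forall>y\<in>carrier A. \<phi> (vmult A x y) = vmult B (\<phi> x) (\<phi> y))"

definition kalgebra_isomorphic ::
  "('k, 'a, 'x) kalgebra_scheme \<Rightarrow> ('k, 'b, 'y) kalgebra_scheme \<Rightarrow> bool" where
  "kalgebra_isomorphic A B \<longleftrightarrow> (\<exists>\<phi>. kalgebra_iso A B \<phi>)"


section \<open>Free vector spaces and quotients\<close>

text \<open>The free vector space on \<open>B\<close> consists of the \<open>f :: 'b \<Rightarrow>\<^sub>0 'k\<close> with \<open>keys f \<subseteq> B\<close>.\<close>

definition pm_scale :: "'k::field \<Rightarrow> ('b \<Rightarrow>\<^sub>0 'k) \<Rightarrow> ('b \<Rightarrow>\<^sub>0 'k)" where
  "pm_scale c f = Poly_Mapping.map ((*) c) f"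

lemma lookup_pm_scale: "Poly_Mapping.lookup (pm_scale c f) x = c * Poly_Mapping.lookup f x"
  by (cases "Poly_Mapping.lookup f x = 0") (simp_all add: pm_scale_def Poly_Mapping.map.rep_eq when_def)

lemma vector_space_pm_scale: "vector_space pm_scale"
  by unfold_locales
     (auto intro!: poly_mapping_eqI simp: lookup_pm_scale lookup_add algebra_simps)

definition pm_filter :: "('b \<Rightarrow> bool) \<Rightarrow> ('b \<Rightarrow>\<^sub>0 'k) \<Rightarrow> ('b \<Rightarrow>\<^sub>0 'k::field)" where
  "pm_filter P f = (\<Sum>x\<in>{x \<in> Poly_Mapping.keys f. P x}. Poly_Mapping.single x (Poly_Mapping.lookup f x))"

text \<open>The bilinear extension of a product given on basis elements.\<close>

definition pm_bilinear ::
  "('b \<Rightarrow> 'b \<Rightarrow> ('b \<Rightarrow>\<^sub>0 'k)) \<Rightarrow> ('b \<Rightarrow>\<^sub>0 'k) \<Rightarrow> ('b \<Rightarrow>\<^sub>0 'k) \<Rightarrow> ('b \<Rightarrow>\<^sub>0 'k::field)" where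
  "pm_bilinear p f g =
     (\<Sum>x\<in>Poly_Mapping.keys f. \<Sum>y\<in>Poly_Mapping.keys g. pm_scale (Poly_Mapping.lookup f x * Poly_Mapping.lookup g y) (p x y))"

definition free_kalgebra ::
  "'b set \<Rightarrow> ('b \<Rightarrow> 'b \<Rightarrow> ('b \<Rightarrow>\<^sub>0 'k)) \<Rightarrow> ('k::field, 'b \<Rightarrow>\<^sub>0 'k) kalgebra" where
  "free_kalgebra B p =
     \<lparr>carrier = {f. Poly_Mapping.keys f \<subseteq> B}, vzero = 0, vadd = (+), vscale = pm_scale, vmult = pm_bilinear p\<rparr>"

definition kcoset :: "('k, 'a) kalgebra \<Rightarrow> 'a set \<Rightarrow> 'a \<Rightarrow> 'a set" where
  "kcoset A N x = vadd A x ` N"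

text \<open>The operations are applied to all representatives; for a two-sided ideal \<open>N\<close> the
  union is a union of equal cosets.\<close>

definition quot_kalgebra :: "('k, 'a) kalgebra \<Rightarrow> 'a set \<Rightarrow> ('k, 'a set) kalgebra" where
  "quot_kalgebra A N =
     \<lparr>carrier = kcoset A N ` carrier A,
      vzero = N,
      vadd = (\<lambda>X Y. \<Union>x\<in>X. \<Union>y\<in>Y. kcoset A N (vadd A x y)),
      vscale = (\<lambda>c X. \<Union>x\<in>X. kcoset A N (vscale A c x)),
      vmult = (\<lambda>X Y. \<Union>x\<in>X. \<Union>y\<in>Y. kcoset A N (vmult A x y))\<rparr>"

definition two_sided_ideal :: "('k, 'a) kalgebra \<Rightarrow> 'a set \<Rightarrow> bool" where
  "two_sided_ideal A I \<longleftrightarrow>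
     I \<subseteq> carrier A \<and> vzero A \<in> I \<and>
     (\<forall>x\<in>I. \<forall>y\<in>I. vadd A x y \<in> I) \<and>
     (\<forall>c. \<forall>x\<in>I. vscale A c x \<in> I) \<and>
     (\<forall>a\<in>carrier A. \<forall>x\<in>I. vmult A a x \<in> I \<and> vmult A x a \<in> I)"

definition generated_ideal :: "('k, 'a) kalgebra \<Rightarrow> 'a set \<Rightarrow> 'a set" where
  "generated_ideal A S = \<Inter>{I. two_sided_ideal A I \<and> S \<subseteq> I}"


section \<open>Tensor products\<close>

text \<open>\<open>A \<otimes> B\<close> is the free vector space on \<open>carrier A \<times> carrier B\<close> modulo the span of the
  bilinearity relations.\<close>

definition tensor_relations ::
  "('k::field, 'a, 'x) kalgebra_scheme \<Rightarrow> ('k, 'b, 'y) kalgebra_scheme \<Rightarrow> ('a \<times> 'b \<Rightarrow>\<^sub>0 'k) set" where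
  "tensor_relations A B =
     {Poly_Mapping.single (vadd A a a', b) 1 - Poly_Mapping.single (a, b) 1
        - Poly_Mapping.single (a', b) 1
      | a a' b. a \<in> carrier A \<and> a' \<in> carrier A \<and> b \<in> carrier B} \<union>
     {Poly_Mapping.single (a, vadd B b b') 1 - Poly_Mapping.single (a, b) 1
        - Poly_Mapping.single (a, b') 1
      | a b b'. a \<in> carrier A \<and> b \<in> carrier B \<and> b' \<in> carrier B} \<union>
     {Poly_Mapping.single (vscale A c a, b) 1 - Poly_Mapping.single (a, b) c
      | c a b. a \<in> carrier A \<and> b \<in> carrier B} \<union>
     {Poly_Mapping.single (a, vscale B c b) 1 - Poly_Mapping.single (a, b) c
      | c a b. a \<in> carrier A \<and> b \<in> carrier B}"

definition tensor_with ::
  "('a \<times> 'b \<Rightarrow> 'a \<times> 'b \<Rightarrow> ('a \<times> 'b \<Rightarrow>\<^sub>0 'k)) \<Rightarrow>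
   ('k::field, 'a, 'x) kalgebra_scheme \<Rightarrow> ('k, 'b, 'y) kalgebra_scheme \<Rightarrow>
   ('k, ('a \<times> 'b \<Rightarrow>\<^sub>0 'k) set) kalgebra" where
  "tensor_with p A B =
     quot_kalgebra (free_kalgebra (carrier A \<times> carrier B) p)
       (module.span pm_scale (tensor_relations A B))"

definition tensor_kalgebra ::
  "('k::field, 'a, 'x) kalgebra_scheme \<Rightarrow> ('k, 'b, 'y) kalgebra_scheme \<Rightarrow>
   ('k, ('a \<times> 'b \<Rightarrow>\<^sub>0 'k) set) kalgebra" where
  "tensor_kalgebra A B =
     tensor_with (\<lambda>(a, c) (b, d). Poly_Mapping.single (vmult A a b, vmult B c d) 1) A B"

text \<open>For homogeneous \<open>b\<close>, \<open>c\<close> the product below is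
  \<open>(a \<otimes> c)(b \<otimes> d) = (-1)^(|c||b|) ab \<otimes> cd\<close>; arbitrary \<open>b\<close>, \<open>c\<close> are split into their
  homogeneous components.\<close>

definition super_tensor_kalgebra ::
  "('k::field, 'a) super_kalgebra \<Rightarrow> ('k, 'b) super_kalgebra \<Rightarrow>
   ('k, ('a \<times> 'b \<Rightarrow>\<^sub>0 'k) set) kalgebra" where
  "super_tensor_kalgebra A B =
     tensor_with
       (\<lambda>(a, c) (b, d). \<Sum>i\<in>{0, 1}. \<Sum>j\<in>{0, 1}.
          Poly_Mapping.single (vmult A a (hcomp A i b), vmult B (hcomp B j c) d) ((-1) ^ (j * i)))
       A B"


section \<open>Cochain twists of group algebras\<close>

definition cochain :: "('g, 'z) monoid_scheme \<Rightarrow> ('g \<Rightarrow> 'g \<Rightarrow> 'k::field) \<Rightarrow> bool" where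
  "cochain G F \<longleftrightarrow>
     (\<forall>x\<in>carrier G. \<forall>y\<in>carrier G. F x y \<noteq> 0) \<and>
     (\<forall>x\<in>carrier G. F \<one>\<^bsub>G\<^esub> x = 1 \<and> F x \<one>\<^bsub>G\<^esub> = 1)"

definition cohomologous ::
  "('g, 'z) monoid_scheme \<Rightarrow> ('g \<Rightarrow> 'g \<Rightarrow> 'k::field) \<Rightarrow> ('g \<Rightarrow> 'g \<Rightarrow> 'k) \<Rightarrow> bool" where
  "cohomologous G F' F \<longleftrightarrow>
     (\<exists>\<chi>. (\<forall>x\<in>carrier G. \<chi> x \<noteq> 0) \<and>
       (\<forall>x\<in>carrier G. \<forall>y\<in>carrier G. F' x y = F x y * \<chi> x * \<chi> y / \<chi> (x \<otimes>\<^bsub>G\<^esub> y)))"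

definition twisted_group_algebra ::
  "('g, 'z) monoid_scheme \<Rightarrow> ('g \<Rightarrow> 'g \<Rightarrow> 'k::field) \<Rightarrow> ('k, 'g \<Rightarrow>\<^sub>0 'k) kalgebra" where
  "twisted_group_algebra G F =
     free_kalgebra (carrier G) (\<lambda>x y. Poly_Mapping.single (x \<otimes>\<^bsub>G\<^esub> y) (F x y))"

text \<open>The basis element \<open>e\<^sub>x\<close> of \<open>k\<^sub>F G\<close>.\<close>

abbreviation basis_elt :: "'g \<Rightarrow> ('g \<Rightarrow>\<^sub>0 'k::field)" where
  "basis_elt x \<equiv> Poly_Mapping.single x 1"

definition super_twisted_group_algebra ::
  "('g, 'z) monoid_scheme \<Rightarrow> ('g \<Rightarrow> 'g \<Rightarrow> 'k::field) \<Rightarrow> ('g \<Rightarrow> int) \<Rightarrow>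
   ('k, 'g \<Rightarrow>\<^sub>0 'k) super_kalgebra" where
  "super_twisted_group_algebra G F \<rho> =
     kalgebra.extend (twisted_group_algebra G F)
       (super_kalgebra.fields (\<lambda>i. pm_filter (\<lambda>x. \<rho> x mod 2 = int i)))"

text \<open>
  In the intended use the exponent is an exact half: if \<open>x \<mapsto> (-1)^\<rho>(x)\<close> defines an
  automorphism of \<open>k\<^sub>F G\<close> and 2 is invertible, then \<open>\<rho>\<close> is additive modulo 2.

  For \<open>G = {1, g}\<close> of order two, \<open>\<rho>(1) = 0\<close>, \<open>\<rho>(g) = 1\<close> and \<open>F = 1\<close> the new cochain has value
  \<open>1/c\<close> at \<open>(g, g)\<close>, and it is cohomologous to \<open>F\<close> if and only if \<open>c\<close> is a square. With
  \<open>c = (-1)^(m(2m-1)) q\<^sub>1 \<cdots> q\<^sub>2\<^sub>m\<close> a square root of \<open>-1\<close> alone does not suffice, as \<open>c = -2\<close> over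
  the field of Gaussian rationals (\<open>m = 1\<close>, \<open>q\<^sub>1 = 1\<close>, \<open>q\<^sub>2 = 2\<close>) shows; a square root of
  \<open>q\<^sub>1 \<cdots> q\<^sub>2\<^sub>m\<close> is needed as well.
\<close>

definition twisted_cochain ::
  "('g, 'z) monoid_scheme \<Rightarrow> ('g \<Rightarrow> 'g \<Rightarrow> 'k::field) \<Rightarrow> ('g \<Rightarrow> int) \<Rightarrow> 'k \<Rightarrow> 'g \<Rightarrow> 'g \<Rightarrow> 'k" where
  "twisted_cochain G F \<rho> c x y = F x y * c powi ((\<rho> (x \<otimes>\<^bsub>G\<^esub> y) - \<rho> x - \<rho> y) div 2)"


section \<open>Quadratic forms and Clifford algebras\<close>

definition polar :: "('v::ab_group_add \<Rightarrow> 'k::field) \<Rightarrow> 'v \<Rightarrow> 'v \<Rightarrow> 'k" where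
  "polar Q u v = Q (u + v) - Q u - Q v"

definition quadratic_form ::
  "('k::field \<Rightarrow> 'v::ab_group_add \<Rightarrow> 'v) \<Rightarrow> ('v \<Rightarrow> 'k) \<Rightarrow> bool" where
  "quadratic_form scl Q \<longleftrightarrow>
     (\<forall>c v. Q (scl c v) = c\<^sup>2 * Q v) \<and> (\<forall>u. Vector_Spaces.linear scl (*) (polar Q u))"

definition nondegenerate :: "('v::ab_group_add \<Rightarrow> 'k::field) \<Rightarrow> bool" where
  "nondegenerate Q \<longleftrightarrow> (\<forall>v. (\<forall>u. polar Q u v = 0) \<longrightarrow> v = 0)"

definition orthogonal_basis ::
  "('k::field \<Rightarrow> 'v::ab_group_add \<Rightarrow> 'v) \<Rightarrow> ('v \<Rightarrow> 'k) \<Rightarrow> nat \<Rightarrow> (nat \<Rightarrow> 'v) \<Rightarrow> bool" where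
  "orthogonal_basis scl Q n e \<longleftrightarrow>
     inj_on e {1..n} \<and>
     \<not> module.dependent scl (e ` {1..n}) \<and>
     module.span scl (e ` {1..n}) = UNIV \<and>
     (\<forall>i\<in>{1..n}. \<forall>j\<in>{1..n}. i \<noteq> j \<longrightarrow> polar Q (e i) (e j) = 0)"

text \<open>The free associative unital algebra on generators \<open>1, \<dots>, n\<close>: its basis consists of the
  words in the generators, multiplied by concatenation; the empty word is the unit.\<close>

definition free_assoc_algebra :: "nat \<Rightarrow> ('k::field, nat list \<Rightarrow>\<^sub>0 'k) kalgebra" where
  "free_assoc_algebra n =
     free_kalgebra (lists {1..n}) (\<lambda>u v. Poly_Mapping.single (u @ v) 1)"

definition clifford_relations :: "nat \<Rightarrow> (nat \<Rightarrow> 'k) \<Rightarrow> (nat list \<Rightarrow>\<^sub>0 'k::field) set" where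
  "clifford_relations n q =
     {Poly_Mapping.single [i, i] 1 - Poly_Mapping.single [] (q i) | i. i \<in> {1..n}} \<union>
     {Poly_Mapping.single [i, j] 1 + Poly_Mapping.single [j, i] 1
      | i j. i \<in> {1..n} \<and> j \<in> {1..n} \<and> i \<noteq> j}"

definition clifford_ideal :: "nat \<Rightarrow> (nat \<Rightarrow> 'k) \<Rightarrow> (nat list \<Rightarrow>\<^sub>0 'k::field) set" where
  "clifford_ideal n q = generated_ideal (free_assoc_algebra n) (clifford_relations n q)"

text \<open>All generators are odd, so the degree of a word is the parity of its length; the
  relations are even, so the grading descends to the quotient.\<close>

definition clifford_algebra ::
  "nat \<Rightarrow> (nat \<Rightarrow> 'k) \<Rightarrow> ('k::field, (nat list \<Rightarrow>\<^sub>0 'k) set) super_kalgebra" where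
  "clifford_algebra n q =
     kalgebra.extend (quot_kalgebra (free_assoc_algebra n) (clifford_ideal n q))
       (super_kalgebra.fields
         (\<lambda>i X. \<Union>f\<in>X. kcoset (free_assoc_algebra n) (clifford_ideal n q)
                         (pm_filter (\<lambda>w. length w mod 2 = i) f)))"

end

theory Submission
  imports Defs
begin

text \<open>
  Let \<open>\<omega> = e\<^sub>1 \<cdots> e\<^sub>2\<^sub>m\<close> be the product of the generators. Because their number is
  even, \<open>\<omega>\<close> anticommutes with every \<open>e\<^sub>i\<close>, and reversing the product shows that \<open>\<omega>\<^sup>2\<close> is the
  scalar \<open>c = (-1)^(m(2m-1)) q\<^sub>1 \<cdots> q\<^sub>2\<^sub>m\<close>. So moving \<open>\<omega>\<close> past a homogeneous element produces exactly
  the Koszul sign, and \<open>e\<^sub>x \<otimes> v \<mapsto> e\<^sub>x \<otimes> \<omega>^\<rho>(x) v\<close> removes the signs from the super tensor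
  product at the price of multiplying \<open>F\<close> by \<open>\<omega>^(\<rho>(xy) - \<rho>(x) - \<rho>(y))\<close>, an integral power of \<open>c\<close>. With
  \<open>D\<^sub>t\<close> the diagonal map \<open>e\<^sub>x \<mapsto> c^\<lfloor>\<rho>(x)/2\<rfloor> e\<^sub>x\<close> on the part of \<open>k\<^sub>F G\<close> where \<open>\<rho> = t\<close> modulo 2,
  this map is \<open>D\<^sub>0 \<otimes> 1 + D\<^sub>1 \<otimes> \<omega>\<close>. If \<open>c = d\<^sup>2\<close>, then \<open>\<chi>(x) = d^(-\<rho>(x))\<close> trivialises the new factor.
\<close>

section \<open>Linear extension on free vector spaces\<close>

interpretation pm: vector_space pm_scale
  by (rule vector_space_pm_scale)

abbreviation pm_hom :: "(('a \<Rightarrow>\<^sub>0 'k::field) \<Rightarrow> ('b \<Rightarrow>\<^sub>0 'k)) \<Rightarrow> bool" where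
  "pm_hom \<equiv> module_hom pm_scale pm_scale"

lemma pm_homI:
  assumes "\<And>x y. f (x + y) = f x + f y" "\<And>c x. f (pm_scale c x) = pm_scale c (f x)"
  shows "pm_hom f"
  using assms by (simp add: module_hom_iff module_iff_vector_space vector_space_pm_scale)

lemmas pm_hom_add = module_hom.add[where ?s1.0 = pm_scale and ?s2.0 = pm_scale]
  and pm_hom_scale = module_hom.scale[where ?s1.0 = pm_scale and ?s2.0 = pm_scale]
  and pm_hom_diff = module_hom.diff[where ?s1.0 = pm_scale and ?s2.0 = pm_scale]
  and pm_hom_sum = module_hom.sum[where ?s1.0 = pm_scale and ?s2.0 = pm_scale]
  and pm_hom_zero = module_hom.zero[where ?s1.0 = pm_scale and ?s2.0 = pm_scale]

lemma pm_hom_comp: "pm_hom f \<Longrightarrow> pm_hom g \<Longrightarrow> pm_hom (\<lambda>x. f (g x))"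
  by (rule pm_homI) (simp_all add: pm_hom_add pm_hom_scale)

lemma pm_hom_id: "pm_hom (\<lambda>x. x)"
  by (rule pm_homI) simp_all

lemma pm_hom_const_scale: "pm_hom f \<Longrightarrow> pm_hom (\<lambda>x. pm_scale c (f x))"
  by (rule pm_homI) (simp_all add: pm_hom_add pm_hom_scale pm.scale_right_distrib mult.commute)

lemma pm_hom_minus: "pm_hom f \<Longrightarrow> pm_hom g \<Longrightarrow> pm_hom (\<lambda>x. f x - g x)"
  by (rule pm_homI) (simp_all add: pm_hom_add pm_hom_scale pm.scale_right_diff_distrib)

lemma pm_scale_single [simp]: "pm_scale c (Poly_Mapping.single x d) = Poly_Mapping.single x (c * d)"
  by (rule poly_mapping_eqI) (simp add: lookup_pm_scale lookup_single when_def)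

lemma keys_pm_scale: "Poly_Mapping.keys (pm_scale c f) \<subseteq> Poly_Mapping.keys f"
  by (auto simp: in_keys_iff lookup_pm_scale)

lemma subspace_keys: "pm.subspace {f. Poly_Mapping.keys f \<subseteq> B}"
  by (rule pm.subspaceI) (auto dest!: keys_add[THEN subsetD] keys_pm_scale[THEN subsetD])

definition pm_linear :: "('a \<Rightarrow> ('b \<Rightarrow>\<^sub>0 'k)) \<Rightarrow> ('a \<Rightarrow>\<^sub>0 'k::field) \<Rightarrow> ('b \<Rightarrow>\<^sub>0 'k)" where
  "pm_linear p f = (\<Sum>x\<in>Poly_Mapping.keys f. pm_scale (Poly_Mapping.lookup f x) (p x))"

text \<open>The terms outside the support are zero. Summing over a common finite index set makes it
  possible to compare sums whose supports differ, which happens when coefficients cancel in an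
  addition or a scalar kills terms.\<close>

lemma pm_linear_superset:
  assumes "finite S" "Poly_Mapping.keys f \<subseteq> S"
  shows "pm_linear p f = (\<Sum>x\<in>S. pm_scale (Poly_Mapping.lookup f x) (p x))"
  unfolding pm_linear_def
  by (rule sum.mono_neutral_left) (use assms in \<open>auto simp: in_keys_iff\<close>)

lemma pm_hom_pm_linear:
  fixes p :: "'a \<Rightarrow> ('b \<Rightarrow>\<^sub>0 'k::field)"
  shows "pm_hom (pm_linear p)"
proof (rule pm_homI)
  fix x y :: "'a \<Rightarrow>\<^sub>0 'k"
  let ?S = "Poly_Mapping.keys x \<union> Poly_Mapping.keys y"
  have "Poly_Mapping.keys (x + y) \<subseteq> ?S" by (rule keys_add)
  then show "pm_linear p (x + y) = pm_linear p x + pm_linear p y"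
    by (simp add: pm_linear_superset[of ?S] lookup_add pm.scale_left_distrib sum.distrib)
next
  fix c and x :: "'a \<Rightarrow>\<^sub>0 'k"
  show "pm_linear p (pm_scale c x) = pm_scale c (pm_linear p x)"
    using keys_pm_scale[of c x]
    by (simp add: pm_linear_superset[of "Poly_Mapping.keys x"] lookup_pm_scale pm.scale_sum_right)
qed

lemma pm_linear_single [simp]: "pm_linear p (Poly_Mapping.single x c) = pm_scale c (p x)"
  by (cases "c = 0") (simp_all add: pm_linear_def)

lemma pm_linear_basis: "pm_linear (\<lambda>x. Poly_Mapping.single x 1) f = f"
proof (rule poly_mapping_eqI)
  fix k
  have "(\<Sum>x\<in>Poly_Mapping.keys f. Poly_Mapping.lookup f x when x = k) = Poly_Mapping.lookup f k"
    by (cases "k \<in> Poly_Mapping.keys f") (simp_all add: when_def in_keys_iff)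
  then show "Poly_Mapping.lookup (pm_linear (\<lambda>x. Poly_Mapping.single x 1) f) k = Poly_Mapping.lookup f k"
    by (simp add: pm_linear_def lookup_sum lookup_single)
qed

text \<open>Expand \<open>x\<close> in the basis and use linearity. Applied to a difference of two
  linear maps, with an ideal as \<open>N\<close>, this reduces every congruence modulo that ideal to
  a check on basis elements.\<close>

lemma pm_hom_in_subspace:
  assumes "pm_hom f" "pm.subspace N" "Poly_Mapping.keys x \<subseteq> B"
    and "\<And>b. b \<in> B \<Longrightarrow> f (Poly_Mapping.single b 1) \<in> N"
  shows "f x \<in> N"
proof -
  have "f x = f (pm_linear (\<lambda>x. Poly_Mapping.single x 1) x)"
    by (simp add: pm_linear_basis)
  also have "\<dots> = (\<Sum>b\<in>Poly_Mapping.keys x. pm_scale (Poly_Mapping.lookup x b) (f (Poly_Mapping.single b 1)))"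
    unfolding pm_linear_def by (simp only: pm_hom_sum[OF assms(1)] pm_hom_scale[OF assms(1)])
  also have "\<dots> \<in> N"
    using assms(3,4) by (intro pm.subspace_sum[OF assms(2)] pm.subspace_scale[OF assms(2)]) auto
  finally show ?thesis .
qed

text \<open>The one-variable criterion is used twice, one argument being frozen each time. The case
  \<open>N = {0}\<close> then gives equality of bilinear maps.\<close>

lemma pm_hom2_in_subspace:
  assumes "\<And>y. pm_hom (\<lambda>x. f x y)" "\<And>x. pm_hom (f x)" "pm.subspace N"
    and "Poly_Mapping.keys x \<subseteq> B" "Poly_Mapping.keys y \<subseteq> B'"
    and "\<And>b b'. b \<in> B \<Longrightarrow> b' \<in> B' \<Longrightarrow> f (Poly_Mapping.single b 1) (Poly_Mapping.single b' 1) \<in> N"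
  shows "f x y \<in> N"
proof (rule pm_hom_in_subspace[OF assms(1,3,4)])
  fix b assume "b \<in> B"
  then show "f (Poly_Mapping.single b 1) y \<in> N"
    by (intro pm_hom_in_subspace[OF assms(2,3,5)] assms(6))
qed

lemma pm_hom2_eqI:
  assumes "\<And>y. pm_hom (\<lambda>x. f x y)" "\<And>x. pm_hom (f x)" "\<And>y. pm_hom (\<lambda>x. g x y)" "\<And>x. pm_hom (g x)"
    and "Poly_Mapping.keys x \<subseteq> B" "Poly_Mapping.keys y \<subseteq> B'"
    and "\<And>b b'. b \<in> B \<Longrightarrow> b' \<in> B' \<Longrightarrow>
      f (Poly_Mapping.single b 1) (Poly_Mapping.single b' 1) = g (Poly_Mapping.single b 1) (Poly_Mapping.single b' 1)"
  shows "f x y = g x y"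
proof -
  have "f x y - g x y \<in> {0}"
    by (rule pm_hom2_in_subspace[where f = "\<lambda>x y. f x y - g x y", OF
          pm_hom_minus[OF assms(1,3)] pm_hom_minus[OF assms(2,4)] pm.subspace_single_0 assms(5,6)])
       (simp add: assms(7))
  then show ?thesis by simp
qed

lemma pm_bilinear_conv: "pm_bilinear p f g = pm_linear (\<lambda>x. pm_linear (p x) g) f"
  by (simp add: pm_bilinear_def pm_linear_def pm.scale_sum_right)

lemma pm_hom_bilinear_left: "pm_hom (\<lambda>f. pm_bilinear p f g)"
  unfolding pm_bilinear_conv by (rule pm_hom_pm_linear)

lemma pm_hom_bilinear_right: "pm_hom (pm_bilinear p f)"
  unfolding pm_bilinear_conv pm_linear_def[of _ f]
  by (rule pm_homI)
     (simp_all add: pm_hom_add[OF pm_hom_pm_linear] pm_hom_scale[OF pm_hom_pm_linear]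
        pm.scale_right_distrib sum.distrib pm.scale_sum_right mult.commute)

lemma pm_bilinear_single [simp]:
  "pm_bilinear p (Poly_Mapping.single x c) (Poly_Mapping.single y d) = pm_scale (c * d) (p x y)"
  by (simp add: pm_bilinear_conv)

lemmas pm_bilinear_add_left = pm_hom_add[OF pm_hom_bilinear_left]
  and pm_bilinear_add_right = pm_hom_add[OF pm_hom_bilinear_right]
  and pm_bilinear_scale_left = pm_hom_scale[OF pm_hom_bilinear_left]
  and pm_bilinear_scale_right = pm_hom_scale[OF pm_hom_bilinear_right]
  and pm_bilinear_diff_left = pm_hom_diff[OF pm_hom_bilinear_left]
  and pm_bilinear_diff_right = pm_hom_diff[OF pm_hom_bilinear_right]

lemma keys_pm_bilinear:
  assumes "Poly_Mapping.keys f \<subseteq> B" "Poly_Mapping.keys g \<subseteq> B"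
    and "\<And>x y. x \<in> B \<Longrightarrow> y \<in> B \<Longrightarrow> Poly_Mapping.keys (p x y) \<subseteq> B"
  shows "Poly_Mapping.keys (pm_bilinear p f g) \<subseteq> B"
  using pm_hom2_in_subspace[OF pm_hom_bilinear_left pm_hom_bilinear_right subspace_keys assms(1,2), of p B] assms(3)
  by simp

text \<open>A single notion covers the homogeneous projections (weights 0 and 1), the parity
  involution on words (weights 1 and -1) and the rescaling by powers of \<open>c\<close>, so that
  linearity and supports are treated once.\<close>

definition pm_diag :: "('a \<Rightarrow> 'k) \<Rightarrow> ('a \<Rightarrow>\<^sub>0 'k::field) \<Rightarrow> ('a \<Rightarrow>\<^sub>0 'k)" where
  "pm_diag u = pm_linear (\<lambda>x. Poly_Mapping.single x (u x))"

lemma pm_hom_pm_diag: "pm_hom (pm_diag u)"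
  unfolding pm_diag_def by (rule pm_hom_pm_linear)

lemma pm_diag_single [simp]: "pm_diag u (Poly_Mapping.single x c) = Poly_Mapping.single x (u x * c)"
  by (simp add: pm_diag_def mult.commute)

lemma lookup_pm_diag [simp]: "Poly_Mapping.lookup (pm_diag u f) k = u k * Poly_Mapping.lookup f k"
proof -
  have "(\<Sum>x\<in>Poly_Mapping.keys f. Poly_Mapping.lookup f x * u x when x = k) = u k * Poly_Mapping.lookup f k"
    by (cases "k \<in> Poly_Mapping.keys f") (simp_all add: when_def in_keys_iff mult.commute if_distrib cong: if_cong)
  then show ?thesis
    by (simp add: pm_diag_def pm_linear_def lookup_sum lookup_single lookup_pm_scale)
qed

lemma keys_pm_diag: "Poly_Mapping.keys f \<subseteq> B \<Longrightarrow> Poly_Mapping.keys (pm_diag u f) \<subseteq> B"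
  by (auto simp: in_keys_iff)

lemma pm_filter_eq_diag: "pm_filter P = pm_diag (\<lambda>x. if P x then 1 else 0)"
proof (intro ext poly_mapping_eqI)
  fix f :: "'a \<Rightarrow>\<^sub>0 'b" and k
  show "Poly_Mapping.lookup (pm_filter P f) k = Poly_Mapping.lookup (pm_diag (\<lambda>x. if P x then 1 else 0) f) k"
    by (cases "k \<in> Poly_Mapping.keys f")
       (auto simp: pm_filter_def lookup_sum lookup_single when_def in_keys_iff)
qed

section \<open>Quotients by two-sided ideals\<close>

abbreviation coset :: "'a::plus set \<Rightarrow> 'a \<Rightarrow> 'a set" where
  "coset N x \<equiv> (+) x ` N"

lemma free_kalgebra_simps [simp]:
  "carrier (free_kalgebra B p) = {f. Poly_Mapping.keys f \<subseteq> B}"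
  "vzero (free_kalgebra B p) = 0"
  "vadd (free_kalgebra B p) = (+)"
  "vscale (free_kalgebra B p) = pm_scale"
  "vmult (free_kalgebra B p) = pm_bilinear p"
  by (simp_all add: free_kalgebra_def)

lemma kcoset_free [simp]: "kcoset (free_kalgebra B p) N x = coset N x"
  by (simp add: kcoset_def)

lemma coset_eq_iff:
  assumes "pm.subspace N"
  shows "coset N x = coset N y \<longleftrightarrow> x - y \<in> N"
proof
  assume "coset N x = coset N y"
  moreover have "x \<in> coset N x" using pm.subspace_0[OF assms] by force
  ultimately show "x - y \<in> N" by auto
next
  have *: "coset N x \<subseteq> coset N y" if "x - y \<in> N" for x y
  proof
    fix z assume "z \<in> coset N x"
    then obtain v where "v \<in> N" "z = x + v" by auto
    then have "z = y + ((x - y) + v)" "(x - y) + v \<in> N"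
      using that pm.subspace_add[OF assms] by auto
    then show "z \<in> coset N y" by blast
  qed
  assume "x - y \<in> N"
  moreover from pm.subspace_neg[OF assms this] have "y - x \<in> N" by simp
  ultimately show "coset N x = coset N y" using * by blast
qed

text \<open>Quotient operations are unions over all representatives. Independence of the
  representative makes all the united cosets equal, so the union collapses to the coset of the
  chosen one.\<close>

lemma UN_coset:
  assumes "pm.subspace N" "\<And>y. y - x \<in> N \<Longrightarrow> f y - f x \<in> M" "pm.subspace M"
  shows "(\<Union>y\<in>coset N x. coset M (f y)) = coset M (f x)"
proof -
  have "coset M (f y) = coset M (f x)" if "y \<in> coset N x" for y
    using that assms(2) by (auto simp: coset_eq_iff[OF assms(3)])
  moreover have "x \<in> coset N x" using pm.subspace_0[OF assms(1)] by force
  ultimately show ?thesis by blast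
qed

lemma subspace_two_sided_ideal: "two_sided_ideal (free_kalgebra B p) N \<Longrightarrow> pm.subspace N"
  by (rule pm.subspaceI) (auto simp: two_sided_ideal_def)

lemma quot_carrier: "carrier (quot_kalgebra (free_kalgebra B p) N) = coset N ` {f. Poly_Mapping.keys f \<subseteq> B}"
  by (simp add: quot_kalgebra_def)

lemma quot_vadd:
  assumes "pm.subspace N"
  shows "vadd (quot_kalgebra (free_kalgebra B p) N) (coset N x) (coset N y) = coset N (x + y)"
proof -
  have "(\<Union>y'\<in>coset N y. coset N (x' + y')) = coset N (x' + y)" for x'
    by (rule UN_coset[OF assms _ assms]) simp
  moreover have "(\<Union>x'\<in>coset N x. coset N (x' + y)) = coset N (x + y)"
    by (rule UN_coset[OF assms _ assms, where f = "\<lambda>x. x + y"]) simp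
  ultimately show ?thesis by (simp add: quot_kalgebra_def)
qed

lemma quot_vscale:
  assumes "pm.subspace N"
  shows "vscale (quot_kalgebra (free_kalgebra B p) N) c (coset N x) = coset N (pm_scale c x)"
proof -
  have "(\<Union>x'\<in>coset N x. coset N (pm_scale c x')) = coset N (pm_scale c x)"
    by (rule UN_coset[OF assms _ assms]) (use pm.subspace_scale[OF assms] in \<open>auto simp flip: pm.scale_right_diff_distrib\<close>)
  then show ?thesis by (simp add: quot_kalgebra_def)
qed

lemma quot_vmult:
  assumes I: "two_sided_ideal (free_kalgebra B p) N"
    and xy: "Poly_Mapping.keys x \<subseteq> B" "Poly_Mapping.keys y \<subseteq> B"
  shows "vmult (quot_kalgebra (free_kalgebra B p) N) (coset N x) (coset N y) = coset N (pm_bilinear p x y)"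
proof -
  note S = subspace_two_sided_ideal[OF I]
  \<comment> \<open>An ideal absorbs only products with elements of the carrier, so an arbitrary
    representative \<open>x'\<close> must first be shown to have its support in
    \<open>B\<close>.\<close>
  have *: "(\<Union>y'\<in>coset N y. coset N (pm_bilinear p x' y')) = coset N (pm_bilinear p x' y)"
    if "x' \<in> coset N x" for x'
  proof (rule UN_coset[OF S _ S])
    from that obtain v where "v \<in> N" "x' = x + v" by blast
    then have "Poly_Mapping.keys x' \<subseteq> B"
      using pm.subspace_add[OF subspace_keys[of B], of x v] xy(1) I
      by (auto simp: two_sided_ideal_def)
    then show "pm_bilinear p x' y' - pm_bilinear p x' y \<in> N" if "y' - y \<in> N" for y'
      using that I by (simp add: two_sided_ideal_def flip: pm_bilinear_diff_right)
  qed
  have "(\<Union>x'\<in>coset N x. coset N (pm_bilinear p x' y)) = coset N (pm_bilinear p x y)"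
    by (rule UN_coset[OF S _ S, where f = "\<lambda>x. pm_bilinear p x y"])
       (use I xy(2) in \<open>simp add: two_sided_ideal_def flip: pm_bilinear_diff_left\<close>)
  with * show ?thesis by (simp add: quot_kalgebra_def)
qed

text \<open>Both quotients have the same underlying vector space and differ only in the product. The
  maps \<open>L\<close> and \<open>M\<close> on representatives need to be mutually inverse and
  multiplicative only modulo \<open>N\<close>.\<close>

lemma quot_kalgebra_isomorphic:
  assumes I: "two_sided_ideal (free_kalgebra B p) N" and J: "two_sided_ideal (free_kalgebra B p') N"
    and lin: "pm_hom L" "pm_hom M"
    and car: "\<And>x. Poly_Mapping.keys x \<subseteq> B \<Longrightarrow> Poly_Mapping.keys (L x) \<subseteq> B"
      "\<And>x. Poly_Mapping.keys x \<subseteq> B \<Longrightarrow> Poly_Mapping.keys (M x) \<subseteq> B"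
    and N: "\<And>x. x \<in> N \<Longrightarrow> L x \<in> N" "\<And>x. x \<in> N \<Longrightarrow> M x \<in> N"
    and inv: "\<And>x. Poly_Mapping.keys x \<subseteq> B \<Longrightarrow> L (M x) - x \<in> N"
      "\<And>x. Poly_Mapping.keys x \<subseteq> B \<Longrightarrow> M (L x) - x \<in> N"
    and mult: "\<And>x y. Poly_Mapping.keys x \<subseteq> B \<Longrightarrow> Poly_Mapping.keys y \<subseteq> B \<Longrightarrow>
      L (pm_bilinear p x y) - pm_bilinear p' (L x) (L y) \<in> N"
  shows "kalgebra_isomorphic (quot_kalgebra (free_kalgebra B p) N) (quot_kalgebra (free_kalgebra B p') N)"
proof -
  note S = subspace_two_sided_ideal[OF I]
  define \<phi> where "\<phi> X = (\<Union>x\<in>X. coset N (L x))" for X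
  define \<psi> where "\<psi> X = (\<Union>x\<in>X. coset N (M x))" for X
  have \<phi>: "\<phi> (coset N x) = coset N (L x)" for x
    unfolding \<phi>_def by (rule UN_coset[OF S _ S]) (simp add: N flip: pm_hom_diff[OF lin(1)])
  have \<psi>: "\<psi> (coset N x) = coset N (M x)" for x
    unfolding \<psi>_def by (rule UN_coset[OF S _ S]) (simp add: N flip: pm_hom_diff[OF lin(2)])
  let ?C = "coset N ` {f. Poly_Mapping.keys f \<subseteq> B}"
  have "bij_betw \<phi> ?C ?C"
    by (rule bij_betw_byWitness[where f' = \<psi>])
       (auto simp: \<phi> \<psi> coset_eq_iff[OF S] inv intro!: imageI car)
  then show ?thesis
    unfolding kalgebra_isomorphic_def kalgebra_iso_def
    by (intro exI[of _ \<phi>])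
       (auto simp: quot_carrier quot_vadd[OF S] quot_vscale[OF S] quot_vmult[OF I] quot_vmult[OF J] \<phi> car
          pm_hom_add[OF lin(1)] pm_hom_scale[OF lin(1)] coset_eq_iff[OF S] mult)
qed

text \<open>Every ideal condition passes to intersections. Containment in the carrier requires the
  family to be nonempty, and the carrier itself is a member because it is closed under the product
  and contains \<open>S\<close>.\<close>

lemma two_sided_ideal_generated:
  assumes "\<And>x y. x \<in> B \<Longrightarrow> y \<in> B \<Longrightarrow> Poly_Mapping.keys (p x y) \<subseteq> B"
    and "\<And>f. f \<in> S \<Longrightarrow> Poly_Mapping.keys f \<subseteq> B"
  shows "two_sided_ideal (free_kalgebra B p) (generated_ideal (free_kalgebra B p) S)"
proof -
  have mult: "Poly_Mapping.keys (pm_bilinear p f g) \<subseteq> B"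
    if "Poly_Mapping.keys f \<subseteq> B" "Poly_Mapping.keys g \<subseteq> B" for f g
    using that assms(1) by (rule keys_pm_bilinear)
  have "two_sided_ideal (free_kalgebra B p) {f. Poly_Mapping.keys f \<subseteq> B}"
    unfolding two_sided_ideal_def free_kalgebra_simps
    using pm.subspace_0[OF subspace_keys] pm.subspace_add[OF subspace_keys]
      pm.subspace_scale[OF subspace_keys] mult
    by (intro conjI ballI allI subset_refl) (assumption | simp only: mem_Collect_eq)+
  then have C: "{f. Poly_Mapping.keys f \<subseteq> B} \<in> {I. two_sided_ideal (free_kalgebra B p) I \<and> S \<subseteq> I}"
    using assms(2) by blast
  show ?thesis
    unfolding generated_ideal_def two_sided_ideal_def[of _ "\<Inter>_"]
  proof (intro conjI ballI allI InterI)
    show "\<Inter>{I. two_sided_ideal (free_kalgebra B p) I \<and> S \<subseteq> I} \<subseteq> carrier (free_kalgebra B p)"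
      using Inter_lower[OF C] by simp
  qed (((drule InterD, assumption)+)?, simp add: two_sided_ideal_def)+
qed

section \<open>Word calculus in the Clifford algebra\<close>

context
  fixes n :: nat and q :: "nat \<Rightarrow> 'k::field"
begin

lemma two_sided_ideal_clifford: "two_sided_ideal (free_assoc_algebra n) (clifford_ideal n q)"
  unfolding clifford_ideal_def free_assoc_algebra_def
proof (rule two_sided_ideal_generated)
  fix f assume "f \<in> clifford_relations n q"
  then show "Poly_Mapping.keys f \<subseteq> lists {1..n}"
    by (auto simp: clifford_relations_def dest!: keys_add[THEN subsetD] keys_diff[THEN subsetD] split: if_splits)
qed auto

lemmas two_sided_ideal_clifford' = two_sided_ideal_clifford[unfolded free_assoc_algebra_def]

lemma clifford_relations_subset: "clifford_relations n q \<subseteq> clifford_ideal n q"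
  by (auto simp: clifford_ideal_def generated_ideal_def)

lemmas subspace_clifford = subspace_two_sided_ideal[OF two_sided_ideal_clifford']

text \<open>A rewriting relation on words that records the accumulated scalar: the word
  \<open>u\<close> represents \<open>c\<close> times \<open>v\<close> in the Clifford algebra.
  Composing steps multiplies scalars, so signs and factors \<open>q i\<close> are computed along the
  way.\<close>

definition wcong :: "'k \<Rightarrow> nat list \<Rightarrow> nat list \<Rightarrow> bool" where
  "wcong c u v \<longleftrightarrow> Poly_Mapping.single u 1 - Poly_Mapping.single v c \<in> clifford_ideal n q"

lemma wcong_refl: "wcong 1 u u"
  using pm.subspace_0[OF subspace_clifford] by (simp add: wcong_def)

lemma wcong_trans:
  assumes "wcong c u v" "wcong d v w" shows "wcong (c * d) u w"
proof -
  have "Poly_Mapping.single u 1 - Poly_Mapping.single w (c * d) =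
      (Poly_Mapping.single u 1 - Poly_Mapping.single v c)
      + pm_scale c (Poly_Mapping.single v 1 - Poly_Mapping.single w d)"
    by (simp add: pm.scale_right_diff_distrib)
  then show ?thesis
    using assms unfolding wcong_def
    by (simp only: pm.subspace_add[OF subspace_clifford] pm.subspace_scale[OF subspace_clifford])
qed

lemma wcong_context:
  assumes "wcong c u v" "p \<in> lists {1..n}" "s \<in> lists {1..n}"
  shows "wcong c (p @ u @ s) (p @ v @ s)"
proof -
  let ?m = "pm_bilinear (\<lambda>u v. Poly_Mapping.single (u @ v) (1::'k))"
  have "?m (Poly_Mapping.single p 1) (?m (Poly_Mapping.single u 1 - Poly_Mapping.single v c) (Poly_Mapping.single s 1))
      \<in> clifford_ideal n q"
    using assms two_sided_ideal_clifford' by (auto simp: wcong_def two_sided_ideal_def)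
  then show ?thesis
    by (simp add: wcong_def pm_bilinear_diff_left pm_bilinear_diff_right)
qed

lemma wcong_square: "i \<in> {1..n} \<Longrightarrow> wcong (q i) [i, i] []"
  using clifford_relations_subset by (auto simp: wcong_def clifford_relations_def)

lemma wcong_swap: "i \<in> {1..n} \<Longrightarrow> j \<in> {1..n} \<Longrightarrow> i \<noteq> j \<Longrightarrow> wcong (- 1) [i, j] [j, i]"
  using clifford_relations_subset by (auto simp: wcong_def clifford_relations_def single_uminus)

text \<open>Each letter passed contributes one sign. Since \<open>i\<close> does not occur in
  \<open>w\<close>, only the anticommutation relation is ever used.\<close>

lemma wcong_move:
  assumes "i \<in> {1..n}" "w \<in> lists {1..n}" "i \<notin> set w"
  shows "wcong ((- 1) ^ length w) (i # w) (w @ [i])"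
  using assms(2,3)
proof (induction w)
  case Nil
  then show ?case by (simp add: wcong_refl)
next
  case (Cons j w)
  have "wcong (- 1) ([] @ [i, j] @ w) ([] @ [j, i] @ w)"
    using Cons assms(1) by (intro wcong_context wcong_swap) auto
  moreover have "wcong ((- 1) ^ length w) ([j] @ (i # w) @ []) ([j] @ (w @ [i]) @ [])"
    using Cons by (intro wcong_context) auto
  ultimately show ?case
    using wcong_trans by force
qed

text \<open>For \<open>k = n\<close> this word represents \<open>\<omega>\<close>. The shorter
  products are included because the square of \<open>\<omega>\<close> is computed by induction on
  the number of factors.\<close>

definition top_word :: "nat \<Rightarrow> nat list" where
  "top_word k = [1..<Suc k]"

lemma length_top_word [simp]: "length (top_word k) = k"
  by (simp add: top_word_def del: upt_Suc)

lemma top_word_in_lists: "k \<le> n \<Longrightarrow> top_word k \<in> lists {1..n}"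
  by (auto simp: top_word_def)

text \<open>Moving the last letter of the first copy across the first \<open>k\<close> letters of
  the second costs \<open>(-1)^k\<close>; there it meets its twin and yields
  \<open>q (Suc k)\<close>. The exponents of the sign add up to the triangular number.\<close>

lemma top_word_square:
  "k \<le> n \<Longrightarrow> wcong ((- 1) ^ (k * (k - 1) div 2) * (\<Prod>i\<in>{1..k}. q i)) (top_word k @ top_word k) []"
proof (induction k)
  case 0
  then show ?case by (simp add: top_word_def wcong_refl)
next
  case (Suc k)
  let ?t = "top_word k" and ?k = "Suc k"
  have t: "?t \<in> lists {1..n}" using Suc.prems by (intro top_word_in_lists) simp
  have split: "top_word ?k = ?t @ [?k]" by (simp add: top_word_def)
  \<comment> \<open>Only the new letter of the first factor travels; afterwards the two copies of
    \<open>?t\<close> are adjacent and the induction hypothesis applies.\<close>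
  have "wcong ((- 1) ^ length ?t) (?t @ (?k # ?t) @ [?k]) (?t @ (?t @ [?k]) @ [?k])"
    using t Suc.prems by (intro wcong_context wcong_move) (auto simp: top_word_def)
  moreover have "wcong (q ?k) ((?t @ ?t) @ [?k, ?k] @ []) ((?t @ ?t) @ [] @ [])"
    using t Suc.prems by (intro wcong_context wcong_square) auto
  moreover have "wcong ((- 1) ^ (k * (k - 1) div 2) * (\<Prod>i\<in>{1..k}. q i)) (?t @ ?t) []"
    using Suc by simp
  ultimately have "wcong ((- 1) ^ k * (q ?k * ((- 1) ^ (k * (k - 1) div 2) * (\<Prod>i\<in>{1..k}. q i))))
      (top_word ?k @ top_word ?k) []"
    unfolding split append_assoc append_Nil append_Nil2 append_Cons length_top_word
    by (blast intro: wcong_trans)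
  moreover have "?k * (?k - 1) div 2 = k + k * (k - 1) div 2"
    by (cases k) (simp_all add: algebra_simps)
  ultimately show ?case
    by (simp add: power_add mult_ac)
qed

text \<open>Write the top word as \<open>u i v\<close>. Moving the extra \<open>i\<close> across
  \<open>u\<close>, and then the next \<open>i\<close> across \<open>v\<close>, costs one sign for
  each of the \<open>n - 1\<close> letters other than \<open>i\<close>. This number is odd because
  \<open>n\<close> is even.\<close>

lemma top_word_anticommute:
  assumes "i \<in> {1..n}" "even n"
  shows "wcong (- 1) (i # top_word n) (top_word n @ [i])"
proof -
  have "i \<in> set (top_word n)" using assms by (auto simp: top_word_def)
  then obtain u v where uv: "top_word n = u @ i # v" by (meson split_list)
  have "distinct (top_word n)" by (simp add: top_word_def)
  then have notin: "i \<notin> set u" "i \<notin> set v" by (auto simp: uv)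
  have lists: "u \<in> lists {1..n}" "v \<in> lists {1..n}"
    using top_word_in_lists[of n] by (auto simp: uv)
  have "wcong ((- 1) ^ length u) ([] @ (i # u) @ (i # v)) ([] @ (u @ [i]) @ (i # v))"
    using lists notin assms by (intro wcong_context wcong_move) auto
  moreover have "wcong ((- 1) ^ length v) ((u @ [i]) @ (i # v) @ []) ((u @ [i]) @ (v @ [i]) @ [])"
    using lists notin assms by (intro wcong_context wcong_move) auto
  ultimately have "wcong ((- 1) ^ (length u + length v)) (i # top_word n) (top_word n @ [i])"
    using wcong_trans by (force simp: uv power_add)
  moreover have "odd (length u + length v)"
    using assms(2) arg_cong[OF uv, of length] by simp
  ultimately show ?thesis by simp
qed

text \<open>One sign arises per letter of \<open>w\<close>, so passing \<open>\<omega>\<close>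
  across a word produces the parity of that word.\<close>

lemma top_word_commute:
  assumes "w \<in> lists {1..n}" "even n"
  shows "wcong ((- 1) ^ length w) (w @ top_word n) (top_word n @ w)"
  using assms(1)
proof (induction w)
  case Nil
  then show ?case by (simp add: wcong_refl)
next
  case (Cons i w)
  have "wcong ((- 1) ^ length w) ([i] @ (w @ top_word n) @ []) ([i] @ (top_word n @ w) @ [])"
    using Cons by (intro wcong_context) auto
  moreover have "wcong (- 1) ([] @ (i # top_word n) @ w) ([] @ (top_word n @ [i]) @ w)"
    using Cons assms(2) by (intro wcong_context top_word_anticommute) auto
  ultimately show ?case
    using wcong_trans by (force simp: mult.commute)
qed

end

section \<open>Superalgebras whose grading is implemented by an element\<close>

definition kclosed :: "('k, 'a, 'x) kalgebra_scheme \<Rightarrow> bool" where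
  "kclosed A \<longleftrightarrow> (\<forall>x\<in>carrier A. \<forall>y\<in>carrier A. vadd A x y \<in> carrier A) \<and>
     (\<forall>c. \<forall>x\<in>carrier A. vscale A c x \<in> carrier A)"

text \<open>These are endomorphisms of the underlying vector space rather than of the algebra, so
  that one-sided multiplications and homogeneous projections qualify.\<close>

definition kendo :: "('k, 'a, 'x) kalgebra_scheme \<Rightarrow> ('a \<Rightarrow> 'a) \<Rightarrow> bool" where
  "kendo A f \<longleftrightarrow> (\<forall>x\<in>carrier A. f x \<in> carrier A) \<and>
     (\<forall>x\<in>carrier A. \<forall>y\<in>carrier A. f (vadd A x y) = vadd A (f x) (f y)) \<and>
     (\<forall>c. \<forall>x\<in>carrier A. f (vscale A c x) = vscale A c (f x))"

definition kbilinear :: "('k, 'a, 'x) kalgebra_scheme \<Rightarrow> ('a \<Rightarrow> 'a \<Rightarrow> 'a) \<Rightarrow> bool" where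
  "kbilinear A \<mu> \<longleftrightarrow> (\<forall>a\<in>carrier A. kendo A (\<mu> a)) \<and> (\<forall>b\<in>carrier A. kendo A (\<lambda>a. \<mu> a b))"

lemma kendo_id: "kendo A (\<lambda>x. x)"
  by (simp add: kendo_def)

lemma kendo_comp: "kendo A f \<Longrightarrow> kendo A g \<Longrightarrow> kendo A (\<lambda>x. f (g x))"
  by (simp add: kendo_def)

text \<open>This isolates the properties of \<open>\<omega>\<close> from which the signs are
  removed: it squares to the scalar \<open>c\<close>, and passing it across \<open>a\<close> applies
  the parity involution to \<open>a\<close>. Associativity is stated only for products involving
  \<open>\<omega>\<close>, each law in the form in which it acts on a further factor
  \<open>b\<close>.\<close>

locale super_implementer =
  fixes B :: "('k::field, 'b) super_kalgebra" and \<omega> :: 'b and c :: 'k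
  assumes closed: "kclosed B"
    and bilinear: "kbilinear B (vmult B)"
    and hcomp_endo: "i \<in> {0, 1} \<Longrightarrow> kendo B (hcomp B i)"
    and hcomp_decomp: "b \<in> carrier B \<Longrightarrow> vadd B (hcomp B 0 b) (hcomp B 1 b) = b"
    and omega_closed: "\<omega> \<in> carrier B"
    and omega_square: "b \<in> carrier B \<Longrightarrow> vmult B \<omega> (vmult B \<omega> b) = vscale B c b"
    and omega_assoc: "a \<in> carrier B \<Longrightarrow> b \<in> carrier B \<Longrightarrow>
      vmult B (vmult B \<omega> a) b = vmult B \<omega> (vmult B a b)"
    and omega_swap: "a \<in> carrier B \<Longrightarrow> b \<in> carrier B \<Longrightarrow>
      vmult B a (vmult B \<omega> b) =
      vmult B \<omega> (vmult B (vadd B (hcomp B 0 a) (vscale B (- 1) (hcomp B 1 a))) b)"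

section \<open>The grading of the Clifford algebra and the product of its generators\<close>

context
  fixes n :: nat and q :: "nat \<Rightarrow> 'k::field"
begin

abbreviation (input) "\<I> \<equiv> clifford_ideal n q"
abbreviation (input) "word_mult \<equiv> pm_bilinear (\<lambda>u v. Poly_Mapping.single (u @ v) (1::'k))"

definition words :: "(nat list \<Rightarrow>\<^sub>0 'k) set" where
  "words = {f. Poly_Mapping.keys f \<subseteq> lists {1..n}}"

lemma words_add: "f \<in> words \<Longrightarrow> g \<in> words \<Longrightarrow> f + g \<in> words"
  unfolding words_def by (rule pm.subspace_add[OF subspace_keys])

lemma words_scale: "f \<in> words \<Longrightarrow> pm_scale d f \<in> words"
  unfolding words_def by (rule pm.subspace_scale[OF subspace_keys])

lemma words_mult: "f \<in> words \<Longrightarrow> g \<in> words \<Longrightarrow> word_mult f g \<in> words"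
  using keys_pm_bilinear[of f "lists {1..n}" g] by (auto simp: words_def)

lemma words_zero: "0 \<in> words"
  by (simp add: words_def)

definition word_sign :: "(nat list \<Rightarrow>\<^sub>0 'k) \<Rightarrow> (nat list \<Rightarrow>\<^sub>0 'k)" where
  "word_sign = pm_diag (\<lambda>w. (- 1) ^ length w)"

lemma pm_hom_word_sign: "pm_hom word_sign"
  unfolding word_sign_def by (rule pm_hom_pm_diag)

lemma word_sign_mult: "word_sign (word_mult f g) = word_mult (word_sign f) (word_sign g)"
  by (rule pm_hom2_eqI[where f = "\<lambda>f g. word_sign (word_mult f g)"
        and g = "\<lambda>f g. word_mult (word_sign f) (word_sign g)" and B = UNIV and B' = UNIV])
     (intro pm_hom_comp[OF pm_hom_word_sign] pm_hom_comp[OF pm_hom_bilinear_right]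
        pm_hom_comp[OF pm_hom_bilinear_left] pm_hom_bilinear_left pm_hom_bilinear_right pm_hom_word_sign
      | simp add: word_sign_def power_add)+

lemma word_sign_words: "f \<in> words \<Longrightarrow> word_sign f \<in> words"
  by (simp add: words_def word_sign_def keys_pm_diag)

text \<open>The elements whose image under the parity involution lies in the ideal form a two-sided
  ideal. It contains the relations, which are fixed because all their words have even length, and
  minimality of the generated ideal concludes.\<close>

lemma word_sign_ideal:
  assumes "f \<in> \<I>" shows "word_sign f \<in> \<I>"
proof -
  let ?J = "{f. f \<in> words \<and> word_sign f \<in> \<I>}"
  note T = two_sided_ideal_clifford'[of n q]
  note S = subspace_clifford[of n q]
  have "two_sided_ideal (free_kalgebra (lists {1..n}) (\<lambda>u v. Poly_Mapping.single (u @ v) 1)) ?J"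
    unfolding two_sided_ideal_def free_kalgebra_simps words_def[symmetric]
  proof (intro conjI ballI allI)
    show "0 \<in> ?J"
      using pm.subspace_0[OF S] by (simp add: words_zero pm_hom_zero[OF pm_hom_word_sign])
    show "x + y \<in> ?J" if "x \<in> ?J" "y \<in> ?J" for x y
      using that words_add[of x y] pm.subspace_add[OF S]
      by (simp add: pm_hom_add[OF pm_hom_word_sign])
    show "pm_scale c x \<in> ?J" if "x \<in> ?J" for c x
      using that words_scale[of x c] pm.subspace_scale[OF S]
      by (simp add: pm_hom_scale[OF pm_hom_word_sign])
    fix a x assume a: "a \<in> words" and x: "x \<in> ?J"
    have "word_mult a x \<in> words" "word_mult x a \<in> words"
      using a x words_mult by blast+
    moreover have "word_mult (word_sign a) (word_sign x) \<in> \<I>" "word_mult (word_sign x) (word_sign a) \<in> \<I>"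
      using T x word_sign_words[OF a] by (auto simp: two_sided_ideal_def words_def)
    ultimately show "word_mult a x \<in> ?J" "word_mult x a \<in> ?J"
      by (simp_all add: word_sign_mult)
  qed auto
  moreover have "clifford_relations n q \<subseteq> ?J"
  proof
    fix r assume r: "r \<in> clifford_relations n q"
    then have "word_sign r = r"
      by (auto simp: clifford_relations_def pm_hom_add[OF pm_hom_word_sign] pm_hom_diff[OF pm_hom_word_sign])
         (simp_all add: word_sign_def)
    moreover have "r \<in> \<I>" using r clifford_relations_subset by blast
    ultimately show "r \<in> ?J" using T by (auto simp: two_sided_ideal_def words_def)
  qed
  ultimately have "\<I> \<subseteq> ?J"
    unfolding clifford_ideal_def free_assoc_algebra_def generated_ideal_def by blast
  with assms show ?thesis by blast
qed

text \<open>The homogeneous components are the eigenprojections of the parity involution. The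
  division by 2 is where the characteristic matters here, and stability under the involution becomes
  stability under projection.\<close>

lemma word_filter_eq:
  fixes f :: "nat list \<Rightarrow>\<^sub>0 'k"
  assumes "(2::'k) \<noteq> 0"
  shows "pm_filter (\<lambda>w. length w mod 2 = 0) f = pm_scale (1 / 2) (f + word_sign f)"
    and "pm_filter (\<lambda>w. length w mod 2 = 1) f = pm_scale (1 / 2) (f - word_sign f)"
proof -
  have par: "(- 1 :: 'k) ^ length w = (if length w mod 2 = 0 then 1 else - 1)" for w :: "nat list"
    by (simp add: even_iff_mod_2_eq_zero[symmetric])
  show "pm_filter (\<lambda>w. length w mod 2 = 0) f = pm_scale (1 / 2) (f + word_sign f)"
    and "pm_filter (\<lambda>w. length w mod 2 = 1) f = pm_scale (1 / 2) (f - word_sign f)"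
    unfolding pm_filter_eq_diag
    by (rule poly_mapping_eqI;
        use assms in \<open>auto simp: word_sign_def lookup_pm_scale lookup_add lookup_minus par field_simps\<close>)+
qed

text \<open>Homogeneity of the ideal is what lets the components descend to the quotient.\<close>

lemma word_filter_ideal:
  assumes "(2::'k) \<noteq> 0" "i \<in> {0, 1}" "f \<in> \<I>"
  shows "pm_filter (\<lambda>w. length w mod 2 = i) f \<in> \<I>"
  using assms(2,3) word_sign_ideal[OF assms(3)] subspace_clifford[of n q]
  by (auto simp: word_filter_eq[OF assms(1)] simp del: One_nat_def
      intro!: pm.subspace_scale pm.subspace_add pm.subspace_diff)

lemma clifford_simps:
  "carrier (clifford_algebra n q) = coset \<I> ` words"
  "vadd (clifford_algebra n q) (coset \<I> f) (coset \<I> g) = coset \<I> (f + g)"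
  "vscale (clifford_algebra n q) c (coset \<I> f) = coset \<I> (pm_scale c f)"
  "f \<in> words \<Longrightarrow> g \<in> words \<Longrightarrow> vmult (clifford_algebra n q) (coset \<I> f) (coset \<I> g) = coset \<I> (word_mult f g)"
  using quot_vmult[OF two_sided_ideal_clifford', where x = f and y = g]
  by (simp_all add: clifford_algebra_def kalgebra.extend_def super_kalgebra.fields_def free_assoc_algebra_def words_def
      quot_carrier quot_vadd[OF subspace_clifford] quot_vscale[OF subspace_clifford])

lemma clifford_hcomp:
  assumes "(2::'k) \<noteq> 0" "i \<in> {0, 1}"
  shows "hcomp (clifford_algebra n q) i (coset \<I> f) = coset \<I> (pm_filter (\<lambda>w. length w mod 2 = i) f)"
proof -
  have "(\<Union>g\<in>coset \<I> f. coset \<I> (pm_filter (\<lambda>w. length w mod 2 = i) g)) =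
      coset \<I> (pm_filter (\<lambda>w. length w mod 2 = i) f)"
    by (rule UN_coset[OF subspace_clifford _ subspace_clifford])
       (use word_filter_ideal[OF assms] in \<open>simp add: pm_filter_eq_diag flip: pm_hom_diff[OF pm_hom_pm_diag]\<close>)
  then show ?thesis
    by (simp add: clifford_algebra_def kalgebra.extend_def super_kalgebra.fields_def free_assoc_algebra_def)
qed

text \<open>By linearity each law about \<open>\<omega>\<close> reduces to words, where it follows
  from the square of the top word, from concatenation, or from the commutation of the top word with
  a word. The scalar is the one found for \<open>k = n\<close>.\<close>

lemma clifford_super_implementer:
  assumes "(2::'k) \<noteq> 0" "even n"
  shows "super_implementer (clifford_algebra n q) (coset \<I> (Poly_Mapping.single (top_word n) 1))
    ((- 1) ^ (n * (n - 1) div 2) * (\<Prod>i\<in>{1..n}. q i))"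
proof -
  let ?C = "clifford_algebra n q" and ?w = "Poly_Mapping.single (top_word n) (1::'k)"
  let ?c = "(- 1) ^ (n * (n - 1) div 2) * (\<Prod>i\<in>{1..n}. q i)"
  let ?F = "\<lambda>i. pm_filter (\<lambda>w::nat list. length w mod 2 = i) :: _ \<Rightarrow> (nat list \<Rightarrow>\<^sub>0 'k)"
  note S = subspace_clifford[of n q]
  have w: "?w \<in> words" using top_word_in_lists[of n n] by (simp add: words_def)
  have words_filter: "?F i f \<in> words" if "f \<in> words" for i f
    using that by (simp add: words_def pm_filter_eq_diag keys_pm_diag)
  have hom_filter: "pm_hom (?F i)" for i
    by (simp add: pm_filter_eq_diag pm_hom_pm_diag)
  have sq: "word_mult ?w (word_mult ?w f) - pm_scale ?c f \<in> \<I>" if "f \<in> words" for f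
  proof (rule pm_hom_in_subspace[where f = "\<lambda>f. word_mult ?w (word_mult ?w f) - pm_scale ?c f", OF _ S])
    show "pm_hom (\<lambda>f. word_mult ?w (word_mult ?w f) - pm_scale ?c f)"
      by (intro pm_hom_minus pm_hom_const_scale pm_hom_id pm_hom_comp[OF pm_hom_bilinear_right] pm_hom_bilinear_right)
    show "Poly_Mapping.keys f \<subseteq> lists {1..n}" using that by (simp add: words_def)
    fix u assume "u \<in> lists {1..n}"
    then have "wcong n q ?c ([] @ (top_word n @ top_word n) @ u) ([] @ [] @ u)"
      by (intro wcong_context top_word_square) auto
    then show "word_mult ?w (word_mult ?w (Poly_Mapping.single u 1)) - pm_scale ?c (Poly_Mapping.single u 1) \<in> \<I>"
      by (simp add: wcong_def)
  qed
  \<comment> \<open>This holds already in the free algebra, since concatenation of words is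
    associative.\<close>
  have assoc: "word_mult (word_mult ?w f) g = word_mult ?w (word_mult f g)" for f g
    by (rule pm_hom2_eqI[where B = UNIV and B' = UNIV])
       (simp_all add: pm_hom_bilinear_left pm_hom_bilinear_right pm_hom_comp[OF pm_hom_bilinear_left]
          pm_hom_comp[OF pm_hom_bilinear_right])
  have swap: "word_mult f (word_mult ?w g) - word_mult ?w (word_mult (word_sign f) g) \<in> \<I>"
    if "f \<in> words" "g \<in> words" for f g
  proof (rule pm_hom2_in_subspace[where f = "\<lambda>f g. word_mult f (word_mult ?w g) - word_mult ?w (word_mult (word_sign f) g)",
        OF _ _ S])
    show "pm_hom (\<lambda>f. word_mult f (word_mult ?w g) - word_mult ?w (word_mult (word_sign f) g))" for g
      by (intro pm_hom_minus pm_hom_bilinear_left pm_hom_comp[OF pm_hom_bilinear_right]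
          pm_hom_comp[OF pm_hom_bilinear_left] pm_hom_word_sign)
    show "pm_hom (\<lambda>g. word_mult f (word_mult ?w g) - word_mult ?w (word_mult (word_sign f) g))" for f
      by (intro pm_hom_minus pm_hom_bilinear_right pm_hom_comp[OF pm_hom_bilinear_right])
    show "Poly_Mapping.keys f \<subseteq> lists {1..n}" "Poly_Mapping.keys g \<subseteq> lists {1..n}"
      using that by (simp_all add: words_def)
    fix u v assume "u \<in> lists {1..n}" "v \<in> lists {1..n}"
    then have "wcong n q ((- 1) ^ length u) ([] @ (u @ top_word n) @ v) ([] @ (top_word n @ u) @ v)"
      using assms(2) by (intro wcong_context top_word_commute) auto
    then show "word_mult (Poly_Mapping.single u 1) (word_mult ?w (Poly_Mapping.single v 1)) -
        word_mult ?w (word_mult (word_sign (Poly_Mapping.single u 1)) (Poly_Mapping.single v 1)) \<in> \<I>"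
      by (simp add: wcong_def word_sign_def)
  qed
  have decomp: "?F 0 f + ?F 1 f = f" for f
    by (rule poly_mapping_eqI) (simp add: pm_filter_eq_diag lookup_add)
  \<comment> \<open>The alternating sum of components that occurs in \<open>omega_swap\<close> is
    the parity involution, for which \<open>swap\<close> was proved.\<close>
  have sign: "?F 0 f + pm_scale (- 1) (?F 1 f) = word_sign f" for f
    by (rule poly_mapping_eqI)
       (simp add: pm_filter_eq_diag lookup_add lookup_pm_scale word_sign_def even_iff_mod_2_eq_zero minus_one_power_iff lookup_minus)
  show ?thesis
  proof
    show "kclosed ?C"
      by (simp add: kclosed_def clifford_simps(1-3) words_add words_scale imageI)
    show "kbilinear ?C (vmult ?C)"
      by (auto simp: kbilinear_def kendo_def clifford_simps words_add words_scale
          pm_bilinear_add_left pm_bilinear_add_right pm_bilinear_scale_left pm_bilinear_scale_right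
          intro!: imageI words_mult)
    show "kendo ?C (hcomp ?C i)" if "i \<in> {0, 1}" for i
      using that
      by (auto simp: kendo_def clifford_simps clifford_hcomp[OF assms(1)] pm_hom_add[OF hom_filter] pm_hom_scale[OF hom_filter]
          simp del: One_nat_def intro!: imageI words_filter)
    show "vadd ?C (hcomp ?C 0 b) (hcomp ?C 1 b) = b" if "b \<in> carrier ?C" for b
      using that by (auto simp: clifford_simps clifford_hcomp[OF assms(1)] decomp simp del: One_nat_def)
    show "coset \<I> ?w \<in> carrier ?C" using w by (simp add: clifford_simps imageI)
    show "vmult ?C (coset \<I> ?w) (vmult ?C (coset \<I> ?w) b) = vscale ?C ?c b" if "b \<in> carrier ?C" for b
      using that w by (clarsimp simp: clifford_simps words_mult sq coset_eq_iff[OF S] simp del: One_nat_def)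
    show "vmult ?C (vmult ?C (coset \<I> ?w) a) b = vmult ?C (coset \<I> ?w) (vmult ?C a b)"
      if "a \<in> carrier ?C" "b \<in> carrier ?C" for a b
      using that w by (auto simp: clifford_simps words_mult assoc)
    show "vmult ?C a (vmult ?C (coset \<I> ?w) b) =
        vmult ?C (coset \<I> ?w) (vmult ?C (vadd ?C (hcomp ?C 0 a) (vscale ?C (- 1) (hcomp ?C 1 a))) b)"
      if "a \<in> carrier ?C" "b \<in> carrier ?C" for a b
      using that w
      by (clarsimp simp: clifford_simps clifford_hcomp[OF assms(1)] sign word_sign_words words_mult swap coset_eq_iff[OF S]
          simp del: One_nat_def pm.scale_minus_left)
  qed
qed

end

section \<open>Products on tensor products\<close>

abbreviation pure :: "'a \<Rightarrow> 'b \<Rightarrow> ('a \<times> 'b \<Rightarrow>\<^sub>0 'k::field)" where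
  "pure a b \<equiv> Poly_Mapping.single (a, b) 1"

locale tensor_spaces =
  fixes A :: "('k::field, 'a, 'x) kalgebra_scheme" and B :: "('k, 'b, 'y) kalgebra_scheme"
  assumes closed_left: "kclosed A" and closed_right: "kclosed B"
begin

definition tcong :: "('a \<times> 'b \<Rightarrow>\<^sub>0 'k) \<Rightarrow> ('a \<times> 'b \<Rightarrow>\<^sub>0 'k) \<Rightarrow> bool" where
  "tcong x y \<longleftrightarrow> x - y \<in> pm.span (tensor_relations A B)"

lemma tcong_refl: "tcong x x"
  by (simp add: tcong_def pm.span_zero)

lemma tcong_sym: "tcong x y \<Longrightarrow> tcong y x"
  unfolding tcong_def using pm.span_neg by force

lemma tcong_trans [trans]: "tcong x y \<Longrightarrow> tcong y z \<Longrightarrow> tcong x z"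
  unfolding tcong_def using pm.span_add by force

lemma tcong_add: "tcong x y \<Longrightarrow> tcong x' y' \<Longrightarrow> tcong (x + x') (y + y')"
  unfolding tcong_def add_diff_add by (rule pm.span_add)

lemma tcong_scale: "tcong x y \<Longrightarrow> tcong (pm_scale r x) (pm_scale r y)"
  unfolding tcong_def by (simp add: pm.span_scale flip: pm.scale_right_diff_distrib)

lemma pure_add_left:
  "a \<in> carrier A \<Longrightarrow> a' \<in> carrier A \<Longrightarrow> b \<in> carrier B \<Longrightarrow> tcong (pure (vadd A a a') b) (pure a b + pure a' b)"
  unfolding tcong_def diff_diff_eq[symmetric] tensor_relations_def by (rule pm.span_base) blast

lemma pure_add_right:
  "a \<in> carrier A \<Longrightarrow> b \<in> carrier B \<Longrightarrow> b' \<in> carrier B \<Longrightarrow> tcong (pure a (vadd B b b')) (pure a b + pure a b')"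
  unfolding tcong_def diff_diff_eq[symmetric] tensor_relations_def by (rule pm.span_base) blast

lemma pure_scale_left:
  "a \<in> carrier A \<Longrightarrow> b \<in> carrier B \<Longrightarrow> tcong (pure (vscale A r a) b) (Poly_Mapping.single (a, b) r)"
  unfolding tcong_def tensor_relations_def by (rule pm.span_base) blast

lemma pure_scale_right:
  "a \<in> carrier A \<Longrightarrow> b \<in> carrier B \<Longrightarrow> tcong (pure a (vscale B r b)) (Poly_Mapping.single (a, b) r)"
  unfolding tcong_def tensor_relations_def by (rule pm.span_base) blast

text \<open>Such an \<open>l\<close> is a bilinear map into the tensor product, given by
  representatives in the free space: additivity and homogeneity hold only up to the tensor
  relations.\<close>

definition balanced :: "('a \<times> 'b \<Rightarrow> ('a \<times> 'b \<Rightarrow>\<^sub>0 'k)) \<Rightarrow> bool" where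
  "balanced l \<longleftrightarrow>
     (\<forall>a\<in>carrier A. \<forall>a'\<in>carrier A. \<forall>b\<in>carrier B. tcong (l (vadd A a a', b)) (l (a, b) + l (a', b))) \<and>
     (\<forall>a\<in>carrier A. \<forall>b\<in>carrier B. \<forall>b'\<in>carrier B. tcong (l (a, vadd B b b')) (l (a, b) + l (a, b'))) \<and>
     (\<forall>r. \<forall>a\<in>carrier A. \<forall>b\<in>carrier B. tcong (l (vscale A r a, b)) (pm_scale r (l (a, b)))) \<and>
     (\<forall>r. \<forall>a\<in>carrier A. \<forall>b\<in>carrier B. tcong (l (a, vscale B r b)) (pm_scale r (l (a, b))))"

text \<open>This is the universal property of the tensor product. The preimage of the span under the
  linear extension is a subspace, and the balancing conditions say exactly that it contains the
  generating relations.\<close>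

lemma balanced_pm_linear:
  assumes "balanced l" "x \<in> pm.span (tensor_relations A B)"
  shows "pm_linear l x \<in> pm.span (tensor_relations A B)"
proof -
  define N where "N = pm.span (tensor_relations A B)"
  have "N \<subseteq> {x. pm_linear l x \<in> N}"
    unfolding N_def
  proof (rule pm.span_minimal, fold N_def)
    show "pm.subspace {x. pm_linear l x \<in> N}"
      unfolding N_def by (rule module_hom.subspace_linear_preimage[OF pm_hom_pm_linear pm.subspace_span])
    show "tensor_relations A B \<subseteq> {x. pm_linear l x \<in> N}"
      using assms(1)[unfolded balanced_def tcong_def, folded N_def]
      by (auto simp: tensor_relations_def diff_diff_eq
          pm_hom_diff[OF pm_hom_pm_linear] pm_hom_add[OF pm_hom_pm_linear])
  qed
  with assms(2) show ?thesis by (auto simp: N_def)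
qed

lemma balanced_pure:
  assumes f: "kendo A f" and g: "kendo B g"
  shows "balanced (\<lambda>(a, b). pure (f a) (g b))"
  using f g by (auto simp: kendo_def balanced_def intro: pure_add_left pure_add_right pure_scale_left pure_scale_right)

lemma balanced_scale:
  assumes "balanced l" shows "balanced (\<lambda>x. pm_scale r (l x))"
proof -
  have "tcong (pm_scale r x) (pm_scale r y + pm_scale r z)" if "tcong x (y + z)" for x y z
    using tcong_scale[OF that] by (simp only: pm.scale_right_distrib)
  moreover have "tcong (pm_scale r x) (pm_scale t (pm_scale r y))" if "tcong x (pm_scale t y)" for t x y
    using tcong_scale[OF that, of r] by (simp only: pm.scale_left_commute[of t r])
  ultimately show ?thesis
    using assms unfolding balanced_def by simp
qed

lemma balanced_add:
  assumes "balanced l" "balanced l'" shows "balanced (\<lambda>x. l x + l' x)"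
proof -
  have "tcong (x + x') (y + y' + (z + z'))" if "tcong x (y + z)" "tcong x' (y' + z')" for x x' y y' z z'
    using tcong_add[OF that] by (simp only: add.assoc add.left_commute)
  moreover have "tcong (x + x') (pm_scale t (y + y'))" if "tcong x (pm_scale t y)" "tcong x' (pm_scale t y')" for t x x' y y'
    using tcong_add[OF that] by (simp only: pm.scale_right_distrib)
  ultimately show ?thesis
    using assms unfolding balanced_def by simp
qed

text \<open>Well-definedness of a product on the tensor space: multiplication by a basis vector on
  either side is a linear extension of a balanced map and hence preserves the span of the relations.
  Linearity extends this to all multipliers.\<close>

lemma two_sided_ideal_tensor:
  assumes "\<And>x y. x \<in> carrier A \<times> carrier B \<Longrightarrow> y \<in> carrier A \<times> carrier B \<Longrightarrow>
      balanced (p x) \<and> balanced (\<lambda>x. p x y)"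
  shows "two_sided_ideal (free_kalgebra (carrier A \<times> carrier B) p) (pm.span (tensor_relations A B))"
proof -
  let ?N = "pm.span (tensor_relations A B)" and ?C = "carrier A \<times> carrier B"
  have "?N \<subseteq> {f. Poly_Mapping.keys f \<subseteq> ?C}"
  proof (rule pm.span_minimal[OF _ subspace_keys], rule subsetI)
    fix r assume "r \<in> tensor_relations A B"
    then show "r \<in> {f. Poly_Mapping.keys f \<subseteq> ?C}"
      using closed_left closed_right
      by (auto simp: tensor_relations_def kclosed_def dest!: keys_diff[THEN subsetD] split: if_splits)
  qed
  moreover have "pm_bilinear p a x \<in> ?N" if a: "Poly_Mapping.keys a \<subseteq> ?C" and x: "x \<in> ?N" for a x
  proof (rule pm_hom_in_subspace[OF pm_hom_bilinear_left pm.subspace_span a])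
    fix b assume b: "b \<in> ?C"
    have "pm_bilinear p (Poly_Mapping.single b 1) x = pm_linear (p b) x"
      by (simp add: pm_bilinear_conv)
    then show "pm_bilinear p (Poly_Mapping.single b 1) x \<in> ?N"
      using assms[OF b b] x by (simp add: balanced_pm_linear)
  qed
  moreover have "pm_bilinear p x a \<in> ?N" if a: "Poly_Mapping.keys a \<subseteq> ?C" and x: "x \<in> ?N" for a x
  proof (rule pm_hom_in_subspace[OF pm_hom_bilinear_right pm.subspace_span a])
    fix b assume b: "b \<in> ?C"
    have "pm_bilinear p x (Poly_Mapping.single b 1) = pm_linear (\<lambda>x. p x b) x"
      by (simp add: pm_bilinear_conv)
    then show "pm_bilinear p x (Poly_Mapping.single b 1) \<in> ?N"
      using assms[OF b b] x by (simp add: balanced_pm_linear)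
  qed
  ultimately show ?thesis
    by (auto simp: two_sided_ideal_def pm.span_zero pm.span_add pm.span_scale)
qed

end

section \<open>Untwisting the super tensor product\<close>

lemma twisted_group_algebra_simps [simp]:
  "carrier (twisted_group_algebra G F) = {f. Poly_Mapping.keys f \<subseteq> carrier G}"
  "vadd (twisted_group_algebra G F) = (+)"
  "vscale (twisted_group_algebra G F) = pm_scale"
  "vmult (twisted_group_algebra G F) = pm_bilinear (\<lambda>x y. Poly_Mapping.single (x \<otimes>\<^bsub>G\<^esub> y) (F x y))"
  by (simp_all add: twisted_group_algebra_def)

lemma super_twisted_group_algebra_simps [simp]:
  "carrier (super_twisted_group_algebra G F \<rho>) = {f. Poly_Mapping.keys f \<subseteq> carrier G}"
  "vadd (super_twisted_group_algebra G F \<rho>) = (+)"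
  "vscale (super_twisted_group_algebra G F \<rho>) = pm_scale"
  "vmult (super_twisted_group_algebra G F \<rho>) = pm_bilinear (\<lambda>x y. Poly_Mapping.single (x \<otimes>\<^bsub>G\<^esub> y) (F x y))"
  "hcomp (super_twisted_group_algebra G F \<rho>) = (\<lambda>i. pm_filter (\<lambda>x. \<rho> x mod 2 = int i))"
  by (simp_all add: super_twisted_group_algebra_def kalgebra.extend_def super_kalgebra.fields_def)

text \<open>The automorphism \<open>\<sigma>\<close> enters here through \<open>parity\<close>, the
  additivity of \<open>\<rho>\<close> modulo 2.\<close>

locale implementer_twist = super_implementer B \<omega> c
  for B :: "('k::field, 'b) super_kalgebra" and \<omega> c +
  fixes G :: "('g, 'z) monoid_scheme" and F :: "'g \<Rightarrow> 'g \<Rightarrow> 'k" and \<rho> :: "'g \<Rightarrow> int"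
  assumes c_nonzero: "c \<noteq> 0"
    and monoid: "monoid G"
    and parity: "x \<in> carrier G \<Longrightarrow> y \<in> carrier G \<Longrightarrow> even (\<rho> (x \<otimes>\<^bsub>G\<^esub> y)) \<longleftrightarrow> even (\<rho> x + \<rho> y)"
begin

lemma vmult_closed: "x \<in> carrier B \<Longrightarrow> y \<in> carrier B \<Longrightarrow> vmult B x y \<in> carrier B"
  and vmult_add_left: "x \<in> carrier B \<Longrightarrow> y \<in> carrier B \<Longrightarrow> z \<in> carrier B \<Longrightarrow>
    vmult B (vadd B x y) z = vadd B (vmult B x z) (vmult B y z)"
  and vmult_add_right: "x \<in> carrier B \<Longrightarrow> y \<in> carrier B \<Longrightarrow> z \<in> carrier B \<Longrightarrow>
    vmult B z (vadd B x y) = vadd B (vmult B z x) (vmult B z y)"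
  and vmult_scale_left: "x \<in> carrier B \<Longrightarrow> z \<in> carrier B \<Longrightarrow> vmult B (vscale B r x) z = vscale B r (vmult B x z)"
  and vmult_scale_right: "x \<in> carrier B \<Longrightarrow> z \<in> carrier B \<Longrightarrow> vmult B z (vscale B r x) = vscale B r (vmult B z x)"
  using bilinear by (simp_all add: kbilinear_def kendo_def)

abbreviation "kG \<equiv> twisted_group_algebra G F"

sublocale tensor_spaces kG B
proof
  show "kclosed kG"
    by (auto simp: kclosed_def dest!: keys_add[THEN subsetD] keys_pm_scale[THEN subsetD])
qed (rule closed)

abbreviation "N \<equiv> pm.span (tensor_relations kG B)"
abbreviation "pairs \<equiv> {f :: 'g \<Rightarrow>\<^sub>0 'k. Poly_Mapping.keys f \<subseteq> carrier G} \<times> carrier B"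

section \<open>The super product and the twisted plain product on one tensor space\<close>

definition super_product :: "('g \<Rightarrow>\<^sub>0 'k) \<times> 'b \<Rightarrow> ('g \<Rightarrow>\<^sub>0 'k) \<times> 'b \<Rightarrow> (('g \<Rightarrow>\<^sub>0 'k) \<times> 'b \<Rightarrow>\<^sub>0 'k)" where
  "super_product = (\<lambda>(a, x) (b, y). \<Sum>i\<in>{0, 1}. \<Sum>j\<in>{0, 1}.
     Poly_Mapping.single (vmult kG a (pm_filter (\<lambda>x. \<rho> x mod 2 = int i) b), vmult B (hcomp B j x) y) ((-1) ^ (j * i)))"

definition plain_product :: "('g \<Rightarrow>\<^sub>0 'k) \<times> 'b \<Rightarrow> ('g \<Rightarrow>\<^sub>0 'k) \<times> 'b \<Rightarrow> (('g \<Rightarrow>\<^sub>0 'k) \<times> 'b \<Rightarrow>\<^sub>0 'k)" where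
  "plain_product = (\<lambda>(a, x) (b, y).
     pure (vmult (twisted_group_algebra G (twisted_cochain G F \<rho> c)) a b) (vmult B x y))"

text \<open>The tensor relations involve only the linear structure, which neither the grading nor
  the cochain changes. Hence both tensor products are quotients of the same free space by the same
  \<open>N\<close>.\<close>

lemma super_tensor_eq:
  "super_tensor_kalgebra (super_twisted_group_algebra G F \<rho>) B = quot_kalgebra (free_kalgebra pairs super_product) N"
  by (simp add: super_tensor_kalgebra_def tensor_with_def tensor_relations_def super_product_def cong: if_cong)

lemma plain_tensor_eq:
  "tensor_kalgebra (twisted_group_algebra G (twisted_cochain G F \<rho> c)) B = quot_kalgebra (free_kalgebra pairs plain_product) N"
  by (simp add: tensor_kalgebra_def tensor_with_def tensor_relations_def plain_product_def)

lemma keys_group_mult: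
  "Poly_Mapping.keys a \<subseteq> carrier G \<Longrightarrow> Poly_Mapping.keys b \<subseteq> carrier G \<Longrightarrow>
   Poly_Mapping.keys (pm_bilinear (\<lambda>x y. Poly_Mapping.single (x \<otimes>\<^bsub>G\<^esub> y) (E x y)) a b) \<subseteq> carrier G"
  by (rule keys_pm_bilinear) (auto simp: monoid.m_closed[OF monoid])

lemma kendo_group_mult:
  assumes "Poly_Mapping.keys a \<subseteq> carrier G"
  shows "kendo kG (vmult (twisted_group_algebra G E) a)"
    and "kendo kG (\<lambda>b. vmult (twisted_group_algebra G E) b a)"
  using assms
  by (simp_all add: kendo_def keys_group_mult pm_bilinear_add_left pm_bilinear_add_right
      pm_bilinear_scale_left pm_bilinear_scale_right)

lemma kendo_diag: "kendo kG (pm_diag u)"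
  by (simp add: kendo_def keys_pm_diag pm_hom_add[OF pm_hom_pm_diag] pm_hom_scale[OF pm_hom_pm_diag])

lemma kendo_vmult:
  assumes "x \<in> carrier B"
  shows "kendo B (vmult B x)" and "kendo B (\<lambda>y. vmult B y x)"
  using assms bilinear by (simp_all add: kbilinear_def)

lemma ideal_plain: "two_sided_ideal (free_kalgebra pairs plain_product) N"
proof -
  have "two_sided_ideal (free_kalgebra (carrier kG \<times> carrier B) plain_product) N"
  proof (rule two_sided_ideal_tensor)
    fix s t assume "s \<in> carrier kG \<times> carrier B" "t \<in> carrier kG \<times> carrier B"
    then show "balanced (plain_product s) \<and> balanced (\<lambda>s. plain_product s t)"
      unfolding plain_product_def
      using balanced_pure[OF kendo_group_mult(1) kendo_vmult(1), of "fst s" "snd s"]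
        balanced_pure[OF kendo_group_mult(2) kendo_vmult(2), of "fst t" "snd t"]
      by (auto simp: case_prod_unfold simp del: twisted_group_algebra_simps(4))
  qed
  then show ?thesis by simp
qed

lemma ideal_super: "two_sided_ideal (free_kalgebra pairs super_product) N"
proof -
  have single: "Poly_Mapping.single z r = pm_scale r (Poly_Mapping.single z 1)"
    for z :: "('g \<Rightarrow>\<^sub>0 'k) \<times> 'b" and r by simp
  have "two_sided_ideal (free_kalgebra (carrier kG \<times> carrier B) super_product) N"
  proof (rule two_sided_ideal_tensor)
    fix s t assume st: "s \<in> carrier kG \<times> carrier B" "t \<in> carrier kG \<times> carrier B"
    let ?P = "\<lambda>i. pm_filter (\<lambda>x. \<rho> x mod 2 = int i)"
    let ?T = "\<lambda>i j (s, s') (t, t'). pm_scale ((- 1) ^ (j * i)) (pure (vmult kG s (?P i t)) (vmult B (hcomp B j s') t'))"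
    have P: "?P i f \<in> carrier kG" if "f \<in> carrier kG" for i f
      using that by (simp add: pm_filter_eq_diag keys_pm_diag)
    have H: "hcomp B j y \<in> carrier B" if "y \<in> carrier B" "j \<in> {0, 1}" for j y
      using that hcomp_endo[of j] by (simp add: kendo_def)
    \<comment> \<open>Splitting both inner factors into components gives four terms. Each is a sign
      times a tensor product of linear maps in either argument, hence balanced.\<close>
    have sp: "super_product = (\<lambda>s t. ?T 0 0 s t + ?T 0 1 s t + (?T 1 0 s t + ?T 1 1 s t))"
      by (intro ext) (simp add: super_product_def split: prod.splits)
    have right: "balanced (?T i j s)" if "i \<in> {0, 1}" "j \<in> {0, 1}" for i j
      using balanced_scale[OF balanced_pure[OF
            kendo_comp[OF kendo_group_mult(1)[of "fst s" F] kendo_diag[of "\<lambda>x. if \<rho> x mod 2 = int i then 1 else 0"]]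
            kendo_vmult(1)[of "hcomp B j (snd s)"]], of "(- 1) ^ (j * i)"] st H[OF _ that(2), of "snd s"]
      by (auto simp: case_prod_unfold pm_filter_eq_diag)
    have left: "balanced (\<lambda>s. ?T i j s t)" if "i \<in> {0, 1}" "j \<in> {0, 1}" for i j
      using balanced_scale[OF balanced_pure[OF kendo_group_mult(2)[of "?P i (fst t)" F]
            kendo_comp[OF kendo_vmult(2)[of "snd t"] hcomp_endo[OF that(2)]]], of "(- 1) ^ (j * i)"] st P[of "fst t" i]
      by (auto simp: case_prod_unfold)
    show "balanced (super_product s) \<and> balanced (\<lambda>s. super_product s t)"
      unfolding sp by (intro conjI balanced_add left right) simp_all
  qed
  then show ?thesis by simp
qed

text \<open>The representative form of \<open>D_u \<otimes> 1 + D_v \<otimes> \<omega>\<close>, with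
  \<open>D_u\<close> and \<open>D_v\<close> diagonal. The weights are left free so that the
  isomorphism and its inverse are both instances.\<close>

definition untwist :: "('g \<Rightarrow> 'k) \<Rightarrow> ('g \<Rightarrow> 'k) \<Rightarrow> (('g \<Rightarrow>\<^sub>0 'k) \<times> 'b \<Rightarrow>\<^sub>0 'k) \<Rightarrow> (('g \<Rightarrow>\<^sub>0 'k) \<times> 'b \<Rightarrow>\<^sub>0 'k)" where
  "untwist u v = pm_linear (\<lambda>(a, b). pure (pm_diag u a) b + pure (pm_diag v a) (vmult B \<omega> b))"

lemma pm_hom_untwist: "pm_hom (untwist u v)"
  unfolding untwist_def by (rule pm_hom_pm_linear)

lemma untwist_single:
  "untwist u v (Poly_Mapping.single (a, b) r) =
    Poly_Mapping.single (pm_diag u a, b) r + Poly_Mapping.single (pm_diag v a, vmult B \<omega> b) r"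
  by (simp add: untwist_def pm.scale_right_distrib)

lemma untwist_ideal:
  assumes "x \<in> N" shows "untwist u v x \<in> N"
proof -
  have "balanced (\<lambda>s. (case s of (a, b) \<Rightarrow> pure (pm_diag u a) b) + (case s of (a, b) \<Rightarrow> pure (pm_diag v a) (vmult B \<omega> b)))"
    by (intro balanced_add balanced_pure kendo_diag kendo_id kendo_vmult omega_closed)
  then have "balanced (\<lambda>(a, b). pure (pm_diag u a) b + pure (pm_diag v a) (vmult B \<omega> b))"
    by (simp add: case_prod_unfold)
  then show ?thesis unfolding untwist_def using assms by (rule balanced_pm_linear)
qed

lemma keys_untwist:
  assumes "Poly_Mapping.keys x \<subseteq> pairs" shows "Poly_Mapping.keys (untwist u v x) \<subseteq> pairs"
proof -
  have "untwist u v x \<in> {f. Poly_Mapping.keys f \<subseteq> pairs}"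
  proof (rule pm_hom_in_subspace[OF pm_hom_untwist subspace_keys assms])
    fix b assume "b \<in> pairs"
    then show "untwist u v (Poly_Mapping.single b 1) \<in> {f. Poly_Mapping.keys f \<subseteq> pairs}"
      using omega_closed
      by (cases b) (auto simp: untwist_single vmult_closed dest!: keys_add[THEN subsetD] keys_pm_diag[OF subset_refl, THEN subsetD])
  qed
  then show ?thesis by simp
qed

text \<open>In the free space the pair \<open>(0, b)\<close> is a nonzero basis vector; it vanishes
  only modulo the relations, by scaling with 0.\<close>

lemma pure_zero: "b \<in> carrier B \<Longrightarrow> tcong (pure 0 b) 0"
  using pure_scale_left[of 0 b 0] by simp

text \<open>Expanding the composite, the two terms with a single \<open>\<omega>\<close> have the
  weights \<open>u v'\<close> and \<open>v u'\<close>, which vanish, while \<open>\<omega>\<close>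
  applied twice becomes \<open>c\<close>. What remains is the identity by the last condition on the
  weights.\<close>

lemma untwist_inverse:
  assumes x: "Poly_Mapping.keys x \<subseteq> pairs"
    and uv: "\<And>k. u k * v' k = 0" "\<And>k. v k * u' k = 0" "\<And>k. u k * u' k + c * (v k * v' k) = 1"
  shows "untwist u v (untwist u' v' x) - x \<in> N"
proof (rule pm_hom_in_subspace[where f = "\<lambda>x. untwist u v (untwist u' v' x) - x", OF _ pm.subspace_span x])
  show "pm_hom (\<lambda>x. untwist u v (untwist u' v' x) - x)"
    by (intro pm_hom_minus pm_hom_id pm_hom_comp[OF pm_hom_untwist] pm_hom_untwist)
  fix s assume "s \<in> pairs"
  then obtain a b where s: "s = (a, b)" and a: "Poly_Mapping.keys a \<subseteq> carrier G" and b: "b \<in> carrier B" by auto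
  have comp: "pm_diag f (pm_diag g a) = pm_diag (\<lambda>k. f k * g k) a" for f g
    by (rule poly_mapping_eqI) (simp add: mult.assoc)
  have zero: "pm_diag (\<lambda>k. 0) a = 0"
    by (rule poly_mapping_eqI) simp
  let ?U = "pm_diag (\<lambda>k. u k * u' k) a" and ?V = "pm_diag (\<lambda>k. v k * v' k) a"
  have UV: "?U \<in> carrier kG" "?V \<in> carrier kG" "pm_scale c ?V \<in> carrier kG"
    using a keys_pm_scale[of c ?V] keys_pm_diag[OF a] by fastforce+
  have sum: "?U + pm_scale c ?V = a"
    by (rule poly_mapping_eqI)
       (use uv(3) in \<open>simp add: lookup_add lookup_pm_scale flip: mult.assoc distrib_right\<close>)
  \<comment> \<open>The scalar \<open>c\<close> from the square of \<open>\<omega>\<close> is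
    carried over to the left factor, where it can be added to \<open>?U\<close>.\<close>
  have "tcong (pure 0 (vmult B \<omega> b) + pure ?V (vscale B c b)) (0 + Poly_Mapping.single (?V, b) c)"
    using b UV omega_closed by (intro tcong_add pure_zero pure_scale_right vmult_closed)
  also have "tcong (0 + Poly_Mapping.single (?V, b) c) (pure (pm_scale c ?V) b)"
    using pure_scale_left[OF UV(2) b, of c] by (simp add: tcong_sym)
  finally have V: "tcong (pure 0 (vmult B \<omega> b) + pure ?V (vscale B c b)) (pure (pm_scale c ?V) b)" .
  have "tcong ((pure ?U b + pure 0 (vmult B \<omega> b)) + (pure 0 (vmult B \<omega> b) + pure ?V (vscale B c b)))
      ((pure ?U b + 0) + pure (pm_scale c ?V) b)"
    using b omega_closed by (intro tcong_add tcong_refl pure_zero V vmult_closed)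
  also have "tcong ((pure ?U b + 0) + pure (pm_scale c ?V) b) (pure a b)"
    using tcong_sym[OF pure_add_left[OF UV(1,3) b]] by (simp add: sum)
  finally have "tcong (untwist u v (untwist u' v' (pure a b))) (pure a b)"
    using b by (simp add: untwist_single pm_hom_add[OF pm_hom_untwist] comp uv zero omega_square)
  then show "untwist u v (untwist u' v' (Poly_Mapping.single s 1)) - Poly_Mapping.single s 1 \<in> N"
    by (simp add: tcong_def s)
qed

section \<open>Multiplicativity of the untwisting map\<close>

definition even_coeff :: "'g \<Rightarrow> 'k" where
  "even_coeff x = (if even (\<rho> x) then c powi (\<rho> x div 2) else 0)"

text \<open>Since \<open>div\<close> rounds down, an odd \<open>\<rho> x\<close> leaves one factor
  \<open>\<omega>\<close> over, and the second summand of \<open>untwist\<close> supplies it. With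
  both weight functions the map is
  \<open>e_x \<otimes> b \<mapsto> e_x \<otimes> \<omega>^\<rho>(x) b\<close>.\<close>

definition odd_coeff :: "'g \<Rightarrow> 'k" where
  "odd_coeff x = (if odd (\<rho> x) then c powi (\<rho> x div 2) else 0)"

text \<open>Rounding down two odd exponents loses two halves, which accounts for the extra
  \<open>c\<close>; in all other cases the halves match by \<open>parity\<close>. Exponents may be
  negative, so splitting the power uses \<open>c \<noteq> 0\<close>.\<close>

lemma coeff_twist:
  assumes "x \<in> carrier G" "y \<in> carrier G"
  shows "F x y * c powi (\<rho> (x \<otimes>\<^bsub>G\<^esub> y) div 2) =
    twisted_cochain G F \<rho> c x y * (c powi (\<rho> x div 2) * c powi (\<rho> y div 2)) * (if odd (\<rho> x) \<and> odd (\<rho> y) then c else 1)"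
proof -
  let ?z = "\<rho> (x \<otimes>\<^bsub>G\<^esub> y)" and ?e = "if odd (\<rho> x) \<and> odd (\<rho> y) then 1 else 0 :: int"
  have "?z div 2 = (?z - \<rho> x - \<rho> y) div 2 + (\<rho> x div 2 + \<rho> y div 2) + ?e"
    using parity[OF assms] by (cases "even (\<rho> x)"; cases "even (\<rho> y)") (auto elim!: evenE oddE)
  moreover have "c powi ?e = (if odd (\<rho> x) \<and> odd (\<rho> y) then c else 1)" by simp
  ultimately show ?thesis
    using c_nonzero by (simp add: twisted_cochain_def power_int_add mult.assoc)
qed

text \<open>Both sides are bilinear in \<open>a\<close> and \<open>b\<close>, so one scalar identity
  for each pair of group elements suffices.\<close>

lemma diag_product:
  assumes a: "Poly_Mapping.keys a \<subseteq> carrier G" and b: "Poly_Mapping.keys b \<subseteq> carrier G"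
    and u: "\<And>x y. x \<in> carrier G \<Longrightarrow> y \<in> carrier G \<Longrightarrow>
      u (x \<otimes>\<^bsub>G\<^esub> y) * F x y * (if p y then 1 else 0) = r * (twisted_cochain G F \<rho> c x y * (v x * w y))"
  shows "pm_diag u (vmult kG a (pm_filter p b)) =
    pm_scale r (vmult (twisted_group_algebra G (twisted_cochain G F \<rho> c)) (pm_diag v a) (pm_diag w b))"
  unfolding pm_filter_eq_diag twisted_group_algebra_simps
proof (rule pm_hom2_eqI[OF _ _ _ _ a b])
  fix x y assume "x \<in> carrier G" "y \<in> carrier G"
  from u[OF this] show "pm_diag u (pm_bilinear (\<lambda>x y. Poly_Mapping.single (x \<otimes>\<^bsub>G\<^esub> y) (F x y))
        (basis_elt x) (pm_diag (\<lambda>x. if p x then 1 else 0) (basis_elt y))) =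
      pm_scale r (pm_bilinear (\<lambda>x y. Poly_Mapping.single (x \<otimes>\<^bsub>G\<^esub> y) (twisted_cochain G F \<rho> c x y))
        (pm_diag v (basis_elt x)) (pm_diag w (basis_elt y)))"
    by (simp add: mult_ac)
qed (intro pm_hom_const_scale pm_hom_comp[OF pm_hom_pm_diag] pm_hom_comp[OF pm_hom_bilinear_left]
    pm_hom_comp[OF pm_hom_bilinear_right] pm_hom_pm_diag pm_hom_bilinear_left pm_hom_bilinear_right)+

text \<open>The parities of \<open>b\<close> and of the product determine that of \<open>a\<close>,
  which selects the weights on the right. When \<open>a\<close> and \<open>b\<close> are both odd,
  the factor \<open>c\<close> stands for the two copies of \<open>\<omega>\<close> that
  meet.\<close>

lemma diag_super_product:
  assumes a: "Poly_Mapping.keys a \<subseteq> carrier G" and b: "Poly_Mapping.keys b \<subseteq> carrier G"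
  defines "X \<equiv> \<lambda>i. vmult kG a (pm_filter (\<lambda>x. \<rho> x mod 2 = int i) b)"
    and "m \<equiv> vmult (twisted_group_algebra G (twisted_cochain G F \<rho> c))"
  shows "pm_diag even_coeff (X 0) = m (pm_diag even_coeff a) (pm_diag even_coeff b)"
    and "pm_diag odd_coeff (X 0) = m (pm_diag odd_coeff a) (pm_diag even_coeff b)"
    and "pm_diag even_coeff (X 1) = pm_scale c (m (pm_diag odd_coeff a) (pm_diag odd_coeff b))"
    and "pm_diag odd_coeff (X 1) = m (pm_diag even_coeff a) (pm_diag odd_coeff b)"
proof -
  have par: "\<rho> y mod 2 = int 0 \<longleftrightarrow> even (\<rho> y)" "\<rho> y mod 2 = int 1 \<longleftrightarrow> odd (\<rho> y)" for y
    by presburger+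
  have coeff: "even_coeff (x \<otimes>\<^bsub>G\<^esub> y) * F x y * (if even (\<rho> y) then 1 else 0) =
        1 * (twisted_cochain G F \<rho> c x y * (even_coeff x * even_coeff y))"
      "odd_coeff (x \<otimes>\<^bsub>G\<^esub> y) * F x y * (if even (\<rho> y) then 1 else 0) =
        1 * (twisted_cochain G F \<rho> c x y * (odd_coeff x * even_coeff y))"
      "even_coeff (x \<otimes>\<^bsub>G\<^esub> y) * F x y * (if odd (\<rho> y) then 1 else 0) =
        c * (twisted_cochain G F \<rho> c x y * (odd_coeff x * odd_coeff y))"
      "odd_coeff (x \<otimes>\<^bsub>G\<^esub> y) * F x y * (if odd (\<rho> y) then 1 else 0) =
        1 * (twisted_cochain G F \<rho> c x y * (even_coeff x * odd_coeff y))"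
    if "x \<in> carrier G" "y \<in> carrier G" for x y
    using coeff_twist[OF that] parity[OF that]
    by (cases "even (\<rho> x)"; cases "even (\<rho> y)"; simp add: even_coeff_def odd_coeff_def mult_ac)+
  show "pm_diag even_coeff (X 0) = m (pm_diag even_coeff a) (pm_diag even_coeff b)"
    using diag_product[OF a b coeff(1)] by (simp only: X_def m_def par pm.scale_one)
  show "pm_diag odd_coeff (X 0) = m (pm_diag odd_coeff a) (pm_diag even_coeff b)"
    using diag_product[OF a b coeff(2)] by (simp only: X_def m_def par pm.scale_one)
  show "pm_diag even_coeff (X 1) = pm_scale c (m (pm_diag odd_coeff a) (pm_diag odd_coeff b))"
    using diag_product[OF a b coeff(3)] by (simp only: X_def m_def par)
  show "pm_diag odd_coeff (X 1) = m (pm_diag even_coeff a) (pm_diag odd_coeff b)"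
    using diag_product[OF a b coeff(4)] by (simp only: X_def m_def par pm.scale_one)
qed

text \<open>On pure tensors the Koszul sign for odd \<open>b\<close> replaces the right factor
  \<open>\<gamma>\<close> by its parity image, and so does moving the \<open>\<omega>\<close>
  attached to \<open>b\<close> to the left across \<open>\<gamma>\<close>. The two effects
  match.\<close>

lemma untwist_mult:
  assumes x: "Poly_Mapping.keys x \<subseteq> pairs" and y: "Poly_Mapping.keys y \<subseteq> pairs"
  shows "untwist even_coeff odd_coeff (pm_bilinear super_product x y) -
    pm_bilinear plain_product (untwist even_coeff odd_coeff x) (untwist even_coeff odd_coeff y) \<in> N"
proof (rule pm_hom2_in_subspace[where f = "\<lambda>x y. untwist even_coeff odd_coeff (pm_bilinear super_product x y) -
    pm_bilinear plain_product (untwist even_coeff odd_coeff x) (untwist even_coeff odd_coeff y)", OF _ _ pm.subspace_span x y])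
  let ?L = "untwist even_coeff odd_coeff"
  show "pm_hom (\<lambda>x. ?L (pm_bilinear super_product x y) - pm_bilinear plain_product (?L x) (?L y))" for y
    by (intro pm_hom_minus pm_hom_comp[OF pm_hom_untwist] pm_hom_bilinear_left
        pm_hom_comp[OF pm_hom_bilinear_left] pm_hom_untwist)
  show "pm_hom (\<lambda>y. ?L (pm_bilinear super_product x y) - pm_bilinear plain_product (?L x) (?L y))" for x
    by (intro pm_hom_minus pm_hom_comp[OF pm_hom_untwist] pm_hom_bilinear_right
        pm_hom_comp[OF pm_hom_bilinear_right] pm_hom_untwist)
  fix s t assume "s \<in> pairs" "t \<in> pairs"
  then obtain a \<gamma> b \<delta> where s: "s = (a, \<gamma>)" and t: "t = (b, \<delta>)"
    and a: "Poly_Mapping.keys a \<subseteq> carrier G" and b: "Poly_Mapping.keys b \<subseteq> carrier G"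
    and \<gamma>: "\<gamma> \<in> carrier B" and \<delta>: "\<delta> \<in> carrier B" by auto
  define \<gamma>0 where "\<gamma>0 = hcomp B 0 \<gamma>"
  define \<gamma>1 where "\<gamma>1 = hcomp B 1 \<gamma>"
  have \<gamma>01: "\<gamma>0 \<in> carrier B" "\<gamma>1 \<in> carrier B" "vscale B (- 1) \<gamma>1 \<in> carrier B"
    using \<gamma> hcomp_endo[of 0] hcomp_endo[of 1] closed by (simp_all add: \<gamma>0_def \<gamma>1_def kendo_def kclosed_def)
  let ?m = "vmult B" and ?A = "vmult (twisted_group_algebra G (twisted_cochain G F \<rho> c))"
  let ?X = "\<lambda>i. vmult kG a (pm_filter (\<lambda>x. \<rho> x mod 2 = int i) b)"
  let ?u = "pm_diag even_coeff" and ?v = "pm_diag odd_coeff"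
  have X: "?X i \<in> carrier kG" for i
    using a b by (simp add: pm_filter_eq_diag keys_pm_diag keys_group_mult)
  have D: "?u f \<in> carrier kG" "?v f \<in> carrier kG" if "f \<in> carrier kG" for f
    using that by (simp_all add: keys_pm_diag)
  have AD: "?A f g \<in> carrier kG" if "f \<in> carrier kG" "g \<in> carrier kG" for f g
    using that by (simp add: keys_group_mult)
  have ab: "a \<in> carrier kG" "b \<in> carrier kG" using a b by simp_all
  note X00 = diag_super_product(1)[OF a b] and X10 = diag_super_product(2)[OF a b]
    and X01 = diag_super_product(3)[OF a b] and X11 = diag_super_product(4)[OF a b]
  \<comment> \<open>The image of \<open>\<gamma>\<close> under the parity involution.\<close>
  define \<gamma>' where "\<gamma>' = vadd B \<gamma>0 (vscale B (- 1) \<gamma>1)"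
  have \<gamma>': "\<gamma>' \<in> carrier B" using \<gamma>01 closed by (simp add: \<gamma>'_def kclosed_def)
  have \<gamma>_split: "\<gamma> = vadd B \<gamma>0 \<gamma>1" using hcomp_decomp[OF \<gamma>] by (simp add: \<gamma>0_def \<gamma>1_def)
  have swap: "?m \<gamma> (?m \<omega> y) = ?m \<omega> (?m \<gamma>' y)" if "y \<in> carrier B" for y
    using omega_swap[OF \<gamma> that] by (simp add: \<gamma>'_def \<gamma>0_def \<gamma>1_def)
  have vscale_closed: "vscale B r y \<in> carrier B" if "y \<in> carrier B" for r y
    using that closed by (simp add: kclosed_def)
  note cl = vscale_closed \<gamma> \<delta> \<gamma>01 \<gamma>' omega_closed vmult_closed
  have plus: "tcong (pure Y y + pure Y y') (pure Y (vadd B y y'))"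
    if "Y \<in> carrier kG" "y \<in> carrier B" "y' \<in> carrier B" for Y y y'
    by (rule tcong_sym[OF pure_add_right[OF that]])
  have minus: "tcong (pure Y y + Poly_Mapping.single (Y, y') (- 1)) (pure Y (vadd B y (vscale B (- 1) y')))"
    if "Y \<in> carrier kG" "y \<in> carrier B" "y' \<in> carrier B" for Y y y'
  proof -
    from tcong_trans[OF pure_add_right[OF that(1,2) vscale_closed[OF that(3)]] tcong_add[OF tcong_refl pure_scale_right[OF that(1,3)]]]
    show ?thesis by (rule tcong_sym)
  qed
  \<comment> \<open>The four congruences pair the even or odd part of \<open>b\<close> with the
    weight \<open>?u\<close> or \<open>?v\<close> applied to the product. Their right-hand sides are
    the four terms in the expanded product of the two images.\<close>
  have 1: "tcong (pure (?u (?X 0)) (?m \<gamma>0 \<delta>) + pure (?u (?X 0)) (?m \<gamma>1 \<delta>)) (pure (?A (?u a) (?u b)) (?m \<gamma> \<delta>))"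
    using plus[OF D(1)[OF X[of 0]], of "?m \<gamma>0 \<delta>" "?m \<gamma>1 \<delta>"]
    by (simp only: X00 \<gamma>_split vmult_add_left cl)
  have 2: "tcong (pure (?v (?X 0)) (?m \<omega> (?m \<gamma>0 \<delta>)) + pure (?v (?X 0)) (?m \<omega> (?m \<gamma>1 \<delta>)))
      (pure (?A (?v a) (?u b)) (?m (?m \<omega> \<gamma>) \<delta>))"
    using plus[OF D(2)[OF X[of 0]], of "?m \<omega> (?m \<gamma>0 \<delta>)" "?m \<omega> (?m \<gamma>1 \<delta>)"]
    by (simp only: X10 \<gamma>_split vmult_add_left vmult_add_right omega_assoc cl)
  have 3: "tcong (pure (?u (?X 1)) (?m \<gamma>0 \<delta>) + Poly_Mapping.single (?u (?X 1), ?m \<gamma>1 \<delta>) (- 1))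
      (pure (?A (?v a) (?v b)) (?m (?m \<omega> \<gamma>) (?m \<omega> \<delta>)))"
  proof -
    have "tcong (pure (?u (?X 1)) (?m \<gamma>0 \<delta>) + Poly_Mapping.single (?u (?X 1), ?m \<gamma>1 \<delta>) (- 1)) (pure (?u (?X 1)) (?m \<gamma>' \<delta>))"
      using minus[OF D(1)[OF X[of 1]], of "?m \<gamma>0 \<delta>" "?m \<gamma>1 \<delta>"]
      by (simp only: \<gamma>'_def vmult_add_left vmult_scale_left cl)
    also have "tcong (pure (?u (?X 1)) (?m \<gamma>' \<delta>)) (Poly_Mapping.single (?A (?v a) (?v b), ?m \<gamma>' \<delta>) c)"
      unfolding X01 using pure_scale_left[of "?A (?v a) (?v b)" "?m \<gamma>' \<delta>" c] AD[OF D(2)[OF ab(1)] D(2)[OF ab(2)]] cl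
      by simp
    also have "tcong \<dots> (pure (?A (?v a) (?v b)) (vscale B c (?m \<gamma>' \<delta>)))"
      by (intro tcong_sym[OF pure_scale_right] AD D ab cl)
    \<comment> \<open>Read from left to right, \<open>c\<close> is turned back into two factors
      \<open>\<omega>\<close>, one of which is passed across \<open>\<gamma>'\<close> to restore
      \<open>\<gamma>\<close>.\<close>
    also have "vscale B c (?m \<gamma>' \<delta>) = ?m (?m \<omega> \<gamma>) (?m \<omega> \<delta>)"
      by (simp add: cl omega_assoc swap omega_square)
    finally show ?thesis .
  qed
  have 4: "tcong (pure (?v (?X 1)) (?m \<omega> (?m \<gamma>0 \<delta>)) + Poly_Mapping.single (?v (?X 1), ?m \<omega> (?m \<gamma>1 \<delta>)) (- 1))
      (pure (?A (?u a) (?v b)) (?m \<gamma> (?m \<omega> \<delta>)))"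
    using minus[OF D(2)[OF X[of 1]], of "?m \<omega> (?m \<gamma>0 \<delta>)" "?m \<omega> (?m \<gamma>1 \<delta>)"]
    by (simp only: X11 swap \<gamma>'_def vmult_add_left vmult_add_right vmult_scale_left vmult_scale_right cl)
  have prod: "super_product (a, \<gamma>) (b, \<delta>) =
      pure (?X 0) (?m \<gamma>0 \<delta>) + pure (?X 0) (?m \<gamma>1 \<delta>) + (pure (?X 1) (?m \<gamma>0 \<delta>) + Poly_Mapping.single (?X 1, ?m \<gamma>1 \<delta>) (- 1))"
    by (simp add: super_product_def \<gamma>0_def \<gamma>1_def)
  have "tcong (?L (super_product (a, \<gamma>) (b, \<delta>)))
      (pm_bilinear plain_product (?L (pure a \<gamma>)) (?L (pure b \<delta>)))"
    unfolding prod
    using tcong_add[OF tcong_add[OF 1 2] tcong_add[OF 3 4]]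
    by (simp only: untwist_single pm_hom_add[OF pm_hom_untwist] pm_bilinear_add_left pm_bilinear_add_right
        pm_bilinear_single plain_product_def prod.case mult_1 pm.scale_one add_ac)
  then show "?L (pm_bilinear super_product (Poly_Mapping.single s 1) (Poly_Mapping.single t 1)) -
      pm_bilinear plain_product (?L (Poly_Mapping.single s 1)) (?L (Poly_Mapping.single t 1)) \<in> N"
    by (simp add: s t tcong_def)
qed

lemma super_tensor_isomorphic:
  "kalgebra_isomorphic
     (super_tensor_kalgebra (super_twisted_group_algebra G F \<rho>) B)
     (tensor_kalgebra (twisted_group_algebra G (twisted_cochain G F \<rho> c)) B)"
proof -
  \<comment> \<open>The weights of the inverse map. On the odd part the inverse of
    \<open>\<omega>\<close> is \<open>\<omega>\<close> divided by \<open>c\<close>, hence the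
    additional factor \<open>inverse c\<close>.\<close>
  define u' where "u' x = (if even (\<rho> x) then inverse (c powi (\<rho> x div 2)) else 0)" for x
  define v' where "v' x = (if odd (\<rho> x) then inverse c * inverse (c powi (\<rho> x div 2)) else 0)" for x
  have inv: "even_coeff k * v' k = 0" "odd_coeff k * u' k = 0" "even_coeff k * u' k + c * (odd_coeff k * v' k) = 1"
    "u' k * odd_coeff k = 0" "v' k * even_coeff k = 0" "u' k * even_coeff k + c * (v' k * odd_coeff k) = 1" for k
    using c_nonzero by (simp_all add: even_coeff_def odd_coeff_def u'_def v'_def field_simps)
  show ?thesis
    unfolding super_tensor_eq plain_tensor_eq
    by (rule quot_kalgebra_isomorphic[OF ideal_super ideal_plain
          pm_hom_untwist[of even_coeff odd_coeff] pm_hom_untwist[of u' v']])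
       (intro keys_untwist untwist_ideal untwist_inverse untwist_mult inv; assumption)+
qed

end

section \<open>Trivialising the new factor, and specialisation to the Clifford algebra\<close>

lemma cohomologous_twisted_cochain:
  fixes t :: "'k::field"
  assumes "t \<noteq> 0" "t\<^sup>2 = c"
    and "\<And>x y. x \<in> carrier G \<Longrightarrow> y \<in> carrier G \<Longrightarrow> even (\<rho> (x \<otimes>\<^bsub>G\<^esub> y)) \<longleftrightarrow> even (\<rho> x + \<rho> y)"
  shows "cohomologous G (twisted_cochain G F \<rho> c) F"
  unfolding cohomologous_def
proof (intro exI[of _ "\<lambda>x. t powi (- \<rho> x)"] conjI ballI)
  fix x y assume "x \<in> carrier G" "y \<in> carrier G"
  \<comment> \<open>Parity makes the halved exponent exact, so the power of \<open>c\<close> is a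
    power of \<open>t\<close> with the full exponent, which splits into the three values of the
    coboundary.\<close>
  then have "even (\<rho> (x \<otimes>\<^bsub>G\<^esub> y) - \<rho> x - \<rho> y)" using assms(3) by auto
  then obtain k where k: "\<rho> (x \<otimes>\<^bsub>G\<^esub> y) - \<rho> x - \<rho> y = 2 * k" by (elim evenE)
  have "c powi k = t powi (2 * k)"
    by (simp add: assms(2)[symmetric] power_int_mult)
  also have "2 * k = - \<rho> x + - \<rho> y + \<rho> (x \<otimes>\<^bsub>G\<^esub> y)" using k by simp
  finally show "twisted_cochain G F \<rho> c x y = F x y * t powi - \<rho> x * t powi - \<rho> y / t powi - \<rho> (x \<otimes>\<^bsub>G\<^esub> y)"
    using assms(1) k by (simp add: twisted_cochain_def power_int_add power_int_minus divide_inverse power_int_diff)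
qed (use assms in simp)
theorem proposition3p9:
  fixes G :: "('g, 'z) monoid_scheme"
    and F :: "'g \<Rightarrow> 'g \<Rightarrow> 'k::field"
    and scl :: "'k \<Rightarrow> 'v::ab_group_add \<Rightarrow> 'v"
    and Q :: "'v \<Rightarrow> 'k"
    and m :: nat
    and e :: "nat \<Rightarrow> 'v"
    and q :: "nat \<Rightarrow> 'k"
    and \<sigma> :: "('g \<Rightarrow>\<^sub>0 'k) \<Rightarrow> ('g \<Rightarrow>\<^sub>0 'k)"
    and s :: "'g \<Rightarrow> 'k"
    and \<rho> :: "'g \<Rightarrow> int"
    and F' :: "'g \<Rightarrow> 'g \<Rightarrow> 'k"
  assumes "CHAR('k) \<noteq> 2"
    and "comm_group G" and "finite (carrier G)"
    and "cochain G F"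
    and "vector_space scl"
    and "quadratic_form scl Q" and "nondegenerate Q"
    and "orthogonal_basis scl Q (2 * m) e"
    and "\<forall>i\<in>{1..2 * m}. Q (e i) = q i \<and> q i \<noteq> 0"
    and "kalgebra_iso (twisted_group_algebra G F) (twisted_group_algebra G F) \<sigma>"
    and "\<forall>f\<in>carrier (twisted_group_algebra G F). \<sigma> (\<sigma> f) = f"
    and "\<forall>x\<in>carrier G. \<sigma> (basis_elt x) = pm_scale (s x) (basis_elt x)"
    and "\<forall>x\<in>carrier G. s x = (-1) powi \<rho> x"
    and "F' = twisted_cochain G F \<rho> ((-1) ^ (m * (2 * m - 1)) * (\<Prod>i\<in>{1..2 * m}. q i))"
  shows "kalgebra_isomorphic
           (super_tensor_kalgebra (super_twisted_group_algebra G F \<rho>) (clifford_algebra (2 * m) q))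
           (tensor_kalgebra (twisted_group_algebra G F') (clifford_algebra (2 * m) q))
       \<and> ((\<exists>\<iota>::'k. \<iota>\<^sup>2 = -1) \<and> (\<exists>r. r\<^sup>2 = (\<Prod>i\<in>{1..2 * m}. q i))
           \<longrightarrow> cohomologous G F' F)"
proof -
  let ?c = "(- 1) ^ (m * (2 * m - 1)) * (\<Prod>i\<in>{1..2 * m}. q i)"
  have F': "F' = twisted_cochain G F \<rho> ?c" by fact
  interpret G: comm_group G by fact
  \<comment> \<open>A characteristic dividing 2 is 1 or 2, and a field does not have characteristic
    1.\<close>
  have "CHAR('k) dvd 2 \<longleftrightarrow> CHAR('k) = 2"
    using two_is_prime_nat CHAR_not_1'[where ?'a = 'k] unfolding prime_nat_iff by auto
  then have two: "(2::'k) \<noteq> 0"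
    using assms(1) of_nat_eq_0_iff_char_dvd[of 2, where ?'a = 'k] by simp
  have neq: "(- 1 :: 'k) \<noteq> 1"
    using two by (metis add.right_inverse one_add_one)
  \<comment> \<open>Apply \<open>\<sigma>\<close> to the product of two basis elements and compare
    coefficients. The nonzero value of \<open>F\<close> cancels, so \<open>s\<close> is
    multiplicative, and \<open>-1 \<noteq> 1\<close> turns this into a statement about
    parities.\<close>
  have parity: "even (\<rho> (x \<otimes>\<^bsub>G\<^esub> y)) \<longleftrightarrow> even (\<rho> x + \<rho> y)" if xy: "x \<in> carrier G" "y \<in> carrier G" for x y
  proof -
    let ?A = "twisted_group_algebra G F"
    have car: "basis_elt z \<in> carrier ?A" if "z \<in> carrier G" for z using that by simp
    have "\<sigma> (vmult ?A (basis_elt x) (basis_elt y)) = vmult ?A (\<sigma> (basis_elt x)) (\<sigma> (basis_elt y))"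
      using assms(10) car xy unfolding kalgebra_iso_def by blast
    moreover have "vmult ?A (basis_elt x) (basis_elt y) = vscale ?A (F x y) (basis_elt (x \<otimes>\<^bsub>G\<^esub> y))"
      by simp
    moreover have "\<sigma> (vscale ?A (F x y) (basis_elt (x \<otimes>\<^bsub>G\<^esub> y))) = vscale ?A (F x y) (\<sigma> (basis_elt (x \<otimes>\<^bsub>G\<^esub> y)))"
      using assms(10) car[OF G.m_closed[OF xy]] unfolding kalgebra_iso_def by blast
    ultimately have "Poly_Mapping.single (x \<otimes>\<^bsub>G\<^esub> y) (F x y * s (x \<otimes>\<^bsub>G\<^esub> y)) = Poly_Mapping.single (x \<otimes>\<^bsub>G\<^esub> y) (s x * s y * F x y)"
      using assms(12) xy by simp
    then have "F x y * s (x \<otimes>\<^bsub>G\<^esub> y) = s x * s y * F x y"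
      by (metis lookup_single_eq)
    moreover have "F x y \<noteq> 0" using assms(4) xy by (simp add: cochain_def)
    ultimately have "s (x \<otimes>\<^bsub>G\<^esub> y) = s x * s y" by simp
    moreover have "s z = (if even (\<rho> z) then 1 else - 1)" if "z \<in> carrier G" for z
      using assms(13) that by simp
    ultimately show ?thesis
      using xy neq neq[symmetric] by (simp split: if_splits)
  qed
  have prod: "(\<Prod>i\<in>{1..2 * m}. q i) \<noteq> 0" using assms(9) by simp
  \<comment> \<open>This identifies the triangular exponent for \<open>n = 2 * m\<close> with the
    one in the statement.\<close>
  have half: "2 * m * (2 * m - 1) div 2 = m * (2 * m - 1)" by simp
  interpret super_implementer "clifford_algebra (2 * m) q"
      "coset (clifford_ideal (2 * m) q) (Poly_Mapping.single (top_word (2 * m)) 1)" ?c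
    using clifford_super_implementer[of "2 * m" q] two by (simp only: half) simp
  interpret implementer_twist "clifford_algebra (2 * m) q"
      "coset (clifford_ideal (2 * m) q) (Poly_Mapping.single (top_word (2 * m)) 1)" ?c G F \<rho>
    by unfold_locales (use prod parity in auto)
  have "cohomologous G F' F" if ex: "\<exists>\<iota>::'k. \<iota>\<^sup>2 = -1" "\<exists>r. r\<^sup>2 = (\<Prod>i\<in>{1..2 * m}. q i)"
  proof -
    obtain \<iota> r :: 'k where \<iota>: "\<iota>\<^sup>2 = -1" and r: "r\<^sup>2 = (\<Prod>i\<in>{1..2 * m}. q i)"
      using ex by blast
    \<comment> \<open>A square root of \<open>?c\<close>: the power of \<open>\<iota>\<close>
      accounts for the sign and \<open>r\<close> for the product of the \<open>q i\<close>.\<close>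
    let ?t = "\<iota> ^ (m * (2 * m - 1)) * r"
    have t: "?t\<^sup>2 = ?c"
      by (simp only: power_mult_distrib r \<iota> flip: power_mult) (simp only: mult.commute[of _ 2] power_mult \<iota>)
    moreover have "\<iota> \<noteq> 0" "r \<noteq> 0" using \<iota> r prod by auto
    then have "?t \<noteq> 0" by simp
    ultimately show ?thesis unfolding F' using parity by (intro cohomologous_twisted_cochain)
  qed
  with super_tensor_isomorphic show ?thesis unfolding F' by blast
qed

end
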